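(* Let $(\sigma,N)$ be a Poisson–Nijenhuis structure on a smooth manifold $M$ such that $\sigma$ is invertible. Then the bivector $\pi=\sigma_N+i\sigma$ defines a generalized complex structure (its graph $L_\pi$ is one), with associated map, with respect to $TM\oplus T^*M$, $$\mathcal J_{\sigma,N}=\begin{pmatrix}-N & \sigma_{N^2}+\sigma\\ -\sigma^{-1} & N^*\end{pmatrix}.$$
   Context: A Poisson–Nijenhuis structure is here a pair $(\sigma,N)$ with $\sigma$ a real Poisson bivector and $N:TM\to TM$ a $(1,1)$-tensor satisfying the compatibility conditions $\sigma^\sharp\circ N^*=N\circ\sigma^\sharp$ and $[\alpha,\beta]_{\sigma_N}=[N^*\alpha,\beta]_\sigma+[\alpha,N^*\beta]_\sigma-N^*[\alpha,\beta]_\sigma$ for all one-forms $\alpha,\beta$, where $\sigma_N=N\circ\sigma^\sharp$, $\sigma_{N^2}=N^2\circ\sigma^\sharp$ (identified with bivectors) and, for a bivector $\sigma$, $[\alpha,\beta]_\sigma=\mathcal L_{\sigma^\sharp\alpha}\beta-\mathcal L_{\sigma^\sharp\beta}\alpha-d\,\sigma(\alpha,\beta)$ with $\sigma(\alpha,\beta)=\beta(\sigma^\sharp\alpha)$. The graph of a complex bivector $\pi$ is $L_\pi=\{\pi^\sharp\alpha+\alpha:\alpha\in T^*M\otimes\mathbb C\}\subseteq(TM\oplus T^*M)\otimes\mathbb C$. The bivector $\sigma_N+i\sigma$ equals $i$ times the conjugate of $\sigma+i\sigma_N$. A generalized complex structure is a lagrangian subbundle $L$ of $(TM\oplus T^*M)\otimes\mathbb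 C$ (for the canonical symmetric pairing) that is involutive for the Courant–Dorfman bracket $[X+\xi,Y+\eta]=[X,Y]+\mathcal L_X\eta-\iota_Yd\xi$ and satisfies $L\cap\overline L=0$; the associated map $\mathcal J$ is determined by $L=\{v+i\mathcal Jv : v\in TM\oplus T^*M\}$ (so $L$ is the $(-i)$-eigenbundle).
   Formalization: A Poisson–Nijenhuis structure is taken here to include that the Nijenhuis torsion of N vanishes; with only the two compatibility conditions the claim fails, since σ_N need not be Poisson. *)

theory Defs
  imports "HOL-Analysis.Analysis"
begin

section \<open>Smooth maps between normed spaces\<close>

text \<open>For open \<open>S\<close> in a finite-dimensional space this is the usual notion of a \<open>C^n\<close> map up to
  the differentiability of the last derivative, so that all \<open>n\<close> together give \<open>C^\<infinity>\<close>.\<close>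

primrec times_diff_on ::
    "nat \<Rightarrow> 'a::real_normed_vector set \<Rightarrow> ('a \<Rightarrow> 'b::real_normed_vector) \<Rightarrow> bool" where
  "times_diff_on 0 S f \<longleftrightarrow> continuous_on S f"
| "times_diff_on (Suc n) S f \<longleftrightarrow>
     (\<forall>x\<in>S. f differentiable (at x)) \<and>
     (\<forall>v. times_diff_on n S (\<lambda>x. frechet_derivative f (at x) v))"

definition smooth_on :: "'a::real_normed_vector set \<Rightarrow> ('a \<Rightarrow> 'b::real_normed_vector) \<Rightarrow> bool" where
  "smooth_on S f \<longleftrightarrow> (\<forall>n. times_diff_on n S f)"

definition fderiv :: "('a::real_normed_vector \<Rightarrow> 'b::real_normed_vector) \<Rightarrow> 'a \<Rightarrow> 'a \<Rightarrow>\<^sub>L 'b" where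
  "fderiv f x = Blinfun (frechet_derivative f (at x))"


section \<open>Smooth manifolds\<close>

text \<open>A manifold is the whole of a Hausdorff second countable type, with an atlas of charts
  \<open>(U, \<phi>)\<close>.  The model space is a finite-dimensional inner product space; unlike the class
  \<open>euclidean_space\<close> this includes dimension \<open>0\<close>.\<close>

type_synonym ('a, 'e) chart = "'a set \<times> ('a \<Rightarrow> 'e)"
type_synonym ('a, 'e) atlas = "('a, 'e) chart set"

abbreviation cdom :: "('a, 'e) chart \<Rightarrow> 'a set" where
  "cdom c \<equiv> fst c"

abbreviation cmap :: "('a, 'e) chart \<Rightarrow> 'a \<Rightarrow> 'e" where
  "cmap c \<equiv> snd c"

definition cinv :: "('a, 'e) chart \<Rightarrow> 'e \<Rightarrow> 'a" where
  "cinv c = inv_into (cdom c) (cmap c)"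

definition smooth_manifold ::
    "('a::{t2_space, second_countable_topology}, 'e::real_inner) atlas \<Rightarrow> bool" where
  "smooth_manifold A \<longleftrightarrow>
     (\<exists>B::'e set. finite B \<and> span B = UNIV) \<and>
     (\<Union>c\<in>A. cdom c) = UNIV \<and>
     (\<forall>c\<in>A. open (cdom c) \<and> open (cmap c ` cdom c) \<and>
        homeomorphism (cdom c) (cmap c ` cdom c) (cmap c) (cinv c)) \<and>
     (\<forall>c\<in>A. \<forall>d\<in>A. smooth_on (cmap c ` (cdom c \<inter> cdom d)) (cmap d \<circ> cinv c))"


section \<open>Tangent and cotangent spaces, tensor fields\<close>

text \<open>Every point \<open>p\<close> gets a preferred chart \<open>chart_at A p\<close>, and \<open>T\<^sub>pM\<close> is identified with the
  model space \<open>'e\<close> by the differential of that chart at \<open>p\<close>.  Thus a vector field is a map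
  \<open>'a \<Rightarrow> 'e\<close> and a one-form a map to the dual of \<open>'e\<close>.  The preferred chart jumps from point to
  point, so smoothness and derivatives always refer to the components with respect to one fixed
  chart \<open>c\<close>, obtained through \<open>to_chart A c p\<close>, the differential of \<open>c\<close> at \<open>p\<close> as a map
  from \<open>T\<^sub>pM\<close> to \<open>'e\<close>, and its inverse \<open>from_chart A c p\<close>.\<close>

type_synonym 'e dual = "'e \<Rightarrow>\<^sub>L real"

definition chart_at :: "('a, 'e) atlas \<Rightarrow> 'a \<Rightarrow> ('a, 'e) chart" where
  "chart_at A p = (SOME c. c \<in> A \<and> p \<in> cdom c)"

definition to_chart ::
    "('a, 'e::real_normed_vector) atlas \<Rightarrow> ('a, 'e) chart \<Rightarrow> 'a \<Rightarrow> 'e \<Rightarrow>\<^sub>L 'e" where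
  "to_chart A c p = fderiv (cmap c \<circ> cinv (chart_at A p)) (cmap (chart_at A p) p)"

definition from_chart ::
    "('a, 'e::real_normed_vector) atlas \<Rightarrow> ('a, 'e) chart \<Rightarrow> 'a \<Rightarrow> 'e \<Rightarrow>\<^sub>L 'e" where
  "from_chart A c p = fderiv (cmap (chart_at A p) \<circ> cinv c) (cmap c p)"

text \<open>The transpose \<open>N\<^sup>*\<close> of a linear map.\<close>

definition dual_map :: "('e::real_normed_vector \<Rightarrow>\<^sub>L 'f::real_normed_vector) \<Rightarrow> 'f dual \<Rightarrow>\<^sub>L 'e dual" where
  "dual_map T = Blinfun (\<lambda>\<xi>. \<xi> o\<^sub>L T)"

text \<open>Components in a chart of functions, vector fields, one-forms, \<open>(1,1)\<close>-tensors and
  bivectors; a bivector \<open>\<sigma>\<close> is given by its map \<open>\<sigma>\<^sup>\<sharp>\<close> from \<open>T\<^sup>*M\<close> to \<open>TM\<close>.\<close>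

definition fun_rep :: "('a, 'e) chart \<Rightarrow> ('a \<Rightarrow> real) \<Rightarrow> 'e \<Rightarrow> real" where
  "fun_rep c f = f \<circ> cinv c"

definition vec_rep ::
    "('a, 'e::real_normed_vector) atlas \<Rightarrow> ('a, 'e) chart \<Rightarrow> ('a \<Rightarrow> 'e) \<Rightarrow> 'e \<Rightarrow> 'e" where
  "vec_rep A c X = (\<lambda>x. let p = cinv c x in to_chart A c p (X p))"

definition form_rep ::
    "('a, 'e::real_normed_vector) atlas \<Rightarrow> ('a, 'e) chart \<Rightarrow> ('a \<Rightarrow> 'e dual) \<Rightarrow> 'e \<Rightarrow> 'e dual" where
  "form_rep A c \<alpha> = (\<lambda>x. let p = cinv c x in \<alpha> p o\<^sub>L from_chart A c p)"

definition endo_rep ::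
    "('a, 'e::real_normed_vector) atlas \<Rightarrow> ('a, 'e) chart \<Rightarrow> ('a \<Rightarrow> 'e \<Rightarrow>\<^sub>L 'e) \<Rightarrow> 'e \<Rightarrow> 'e \<Rightarrow>\<^sub>L 'e" where
  "endo_rep A c N = (\<lambda>x. let p = cinv c x in to_chart A c p o\<^sub>L N p o\<^sub>L from_chart A c p)"

definition sharp_rep ::
    "('a, 'e::real_normed_vector) atlas \<Rightarrow> ('a, 'e) chart \<Rightarrow> ('a \<Rightarrow> 'e dual \<Rightarrow>\<^sub>L 'e) \<Rightarrow>
     'e \<Rightarrow> 'e dual \<Rightarrow>\<^sub>L 'e" where
  "sharp_rep A c \<sigma> = (\<lambda>x. let p = cinv c x in
     to_chart A c p o\<^sub>L \<sigma> p o\<^sub>L dual_map (to_chart A c p))"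

definition smooth_fun :: "('a, 'e::real_normed_vector) atlas \<Rightarrow> 'a set \<Rightarrow> ('a \<Rightarrow> real) \<Rightarrow> bool" where
  "smooth_fun A U f \<longleftrightarrow> (\<forall>c\<in>A. smooth_on (cmap c ` (cdom c \<inter> U)) (fun_rep c f))"

definition smooth_vec :: "('a, 'e::real_normed_vector) atlas \<Rightarrow> 'a set \<Rightarrow> ('a \<Rightarrow> 'e) \<Rightarrow> bool" where
  "smooth_vec A U X \<longleftrightarrow> (\<forall>c\<in>A. smooth_on (cmap c ` (cdom c \<inter> U)) (vec_rep A c X))"

definition smooth_form :: "('a, 'e::real_normed_vector) atlas \<Rightarrow> 'a set \<Rightarrow> ('a \<Rightarrow> 'e dual) \<Rightarrow> bool" where
  "smooth_form A U \<alpha> \<longleftrightarrow> (\<forall>c\<in>A. smooth_on (cmap c ` (cdom c \<inter> U)) (form_rep A c \<alpha>))"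

definition smooth_endo :: "('a, 'e::real_normed_vector) atlas \<Rightarrow> ('a \<Rightarrow> 'e \<Rightarrow>\<^sub>L 'e) \<Rightarrow> bool" where
  "smooth_endo A N \<longleftrightarrow> (\<forall>c\<in>A. smooth_on (cmap c ` cdom c) (endo_rep A c N))"

definition bivector :: "('a, 'e::real_normed_vector) atlas \<Rightarrow> ('a \<Rightarrow> 'e dual \<Rightarrow>\<^sub>L 'e) \<Rightarrow> bool" where
  "bivector A \<sigma> \<longleftrightarrow>
     (\<forall>p \<alpha> \<beta>. blinfun_apply \<beta> (\<sigma> p \<alpha>) = - blinfun_apply \<alpha> (\<sigma> p \<beta>)) \<and>
     (\<forall>c\<in>A. smooth_on (cmap c ` cdom c) (sharp_rep A c \<sigma>))"


section \<open>Differential calculus\<close>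

text \<open>All operations are evaluated at \<open>p\<close> by the coordinate formulas in the chart
  \<open>chart_at A p\<close>, whose coordinate basis at \<open>p\<close> is the one identifying \<open>T\<^sub>pM\<close> with \<open>'e\<close>.\<close>

definition differential :: "('a, 'e::real_normed_vector) atlas \<Rightarrow> ('a \<Rightarrow> real) \<Rightarrow> 'a \<Rightarrow> 'e dual" where
  "differential A f p = (let c = chart_at A p in fderiv (fun_rep c f) (cmap c p))"

definition lie_bracket ::
    "('a, 'e::real_normed_vector) atlas \<Rightarrow> ('a \<Rightarrow> 'e) \<Rightarrow> ('a \<Rightarrow> 'e) \<Rightarrow> 'a \<Rightarrow> 'e" where
  "lie_bracket A X Y p = (let c = chart_at A p; x = cmap c p in
     fderiv (vec_rep A c Y) x (X p) - fderiv (vec_rep A c X) x (Y p))"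

text \<open>\<open>(L\<^sub>X \<eta>)\<^sub>i = X\<^sup>j \<partial>\<^sub>j \<eta>\<^sub>i + \<eta>\<^sub>j \<partial>\<^sub>i X\<^sup>j\<close>\<close>

definition lie_deriv ::
    "('a, 'e::real_normed_vector) atlas \<Rightarrow> ('a \<Rightarrow> 'e) \<Rightarrow> ('a \<Rightarrow> 'e dual) \<Rightarrow> 'a \<Rightarrow> 'e dual" where
  "lie_deriv A X \<eta> p = (let c = chart_at A p; x = cmap c p in
     fderiv (form_rep A c \<eta>) x (X p) + (\<eta> p o\<^sub>L fderiv (vec_rep A c X) x))"

definition ext_deriv ::
    "('a, 'e::real_normed_vector) atlas \<Rightarrow> ('a \<Rightarrow> 'e dual) \<Rightarrow> 'a \<Rightarrow> 'e \<Rightarrow> 'e \<Rightarrow> real" where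
  "ext_deriv A \<xi> p v w = (let c = chart_at A p; D = fderiv (form_rep A c \<xi>) (cmap c p) in
     blinfun_apply (D v) w - blinfun_apply (D w) v)"

definition interior_product ::
    "('a \<Rightarrow> 'e::real_normed_vector) \<Rightarrow> ('a \<Rightarrow> 'e \<Rightarrow> 'e \<Rightarrow> real) \<Rightarrow> 'a \<Rightarrow> 'e dual" where
  "interior_product Y \<omega> p = Blinfun (\<lambda>w. \<omega> p (Y p) w)"


section \<open>Poisson-Nijenhuis structures\<close>

definition poisson_bracket ::
    "('a, 'e::real_normed_vector) atlas \<Rightarrow> ('a \<Rightarrow> 'e dual \<Rightarrow>\<^sub>L 'e) \<Rightarrow>
     ('a \<Rightarrow> real) \<Rightarrow> ('a \<Rightarrow> real) \<Rightarrow> 'a \<Rightarrow> real" where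
  "poisson_bracket A \<sigma> f g p = blinfun_apply (differential A g p) (\<sigma> p (differential A f p))"

text \<open>The Jacobi identity is required for the bracket on the sheaf of smooth functions.\<close>

definition poisson :: "('a::topological_space, 'e::real_normed_vector) atlas \<Rightarrow>
    ('a \<Rightarrow> 'e dual \<Rightarrow>\<^sub>L 'e) \<Rightarrow> bool" where
  "poisson A \<sigma> \<longleftrightarrow> bivector A \<sigma> \<and>
     (\<forall>U f g h. open U \<and> smooth_fun A U f \<and> smooth_fun A U g \<and> smooth_fun A U h \<longrightarrow>
        (\<forall>p\<in>U. poisson_bracket A \<sigma> f (poisson_bracket A \<sigma> g h) p +
                poisson_bracket A \<sigma> g (poisson_bracket A \<sigma> h f) p +
                poisson_bracket A \<sigma> h (poisson_bracket A \<sigma> f g) p = 0))"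

text \<open>The bracket \<open>[\<alpha>,\<beta>]\<^sub>\<sigma>\<close> of one-forms.\<close>

definition form_bracket ::
    "('a, 'e::real_normed_vector) atlas \<Rightarrow> ('a \<Rightarrow> 'e dual \<Rightarrow>\<^sub>L 'e) \<Rightarrow>
     ('a \<Rightarrow> 'e dual) \<Rightarrow> ('a \<Rightarrow> 'e dual) \<Rightarrow> 'a \<Rightarrow> 'e dual" where
  "form_bracket A \<sigma> \<alpha> \<beta> p =
     lie_deriv A (\<lambda>q. \<sigma> q (\<alpha> q)) \<beta> p - lie_deriv A (\<lambda>q. \<sigma> q (\<beta> q)) \<alpha> p
     - differential A (\<lambda>q. blinfun_apply (\<beta> q) (\<sigma> q (\<alpha> q))) p"

definition nijenhuis_torsion ::
    "('a, 'e::real_normed_vector) atlas \<Rightarrow> ('a \<Rightarrow> 'e \<Rightarrow>\<^sub>L 'e) \<Rightarrow>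
     ('a \<Rightarrow> 'e) \<Rightarrow> ('a \<Rightarrow> 'e) \<Rightarrow> 'a \<Rightarrow> 'e" where
  "nijenhuis_torsion A N X Y p =
     lie_bracket A (\<lambda>q. N q (X q)) (\<lambda>q. N q (Y q)) p
     - N p (lie_bracket A (\<lambda>q. N q (X q)) Y p + lie_bracket A X (\<lambda>q. N q (Y q)) p
            - N p (lie_bracket A X Y p))"

definition nijenhuis_tensor ::
    "('a, 'e::real_normed_vector) atlas \<Rightarrow> ('a \<Rightarrow> 'e \<Rightarrow>\<^sub>L 'e) \<Rightarrow> bool" where
  "nijenhuis_tensor A N \<longleftrightarrow> smooth_endo A N \<and>
     (\<forall>X Y. smooth_vec A UNIV X \<and> smooth_vec A UNIV Y \<longrightarrow>
        (\<forall>p. nijenhuis_torsion A N X Y p = 0))"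

definition twist ::
    "('a \<Rightarrow> 'e \<Rightarrow>\<^sub>L 'e) \<Rightarrow> ('a \<Rightarrow> 'e dual \<Rightarrow>\<^sub>L 'e) \<Rightarrow> 'a \<Rightarrow> 'e::real_normed_vector dual \<Rightarrow>\<^sub>L 'e" where
  "twist N \<sigma> p = N p o\<^sub>L \<sigma> p"

text \<open>Vanishing of the torsion of \<open>N\<close> is independent of the two compatibility conditions: for
  \<open>\<sigma>\<close> the inverse of a symplectic form \<open>\<omega>\<close>, these only say that \<open>\<omega>(N X, Y)\<close> is a closed
  two-form.\<close>

definition poisson_nijenhuis :: "('a::topological_space, 'e::real_normed_vector) atlas \<Rightarrow>
    ('a \<Rightarrow> 'e dual \<Rightarrow>\<^sub>L 'e) \<Rightarrow> ('a \<Rightarrow> 'e \<Rightarrow>\<^sub>L 'e) \<Rightarrow> bool" where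
  "poisson_nijenhuis A \<sigma> N \<longleftrightarrow>
     poisson A \<sigma> \<and>
     nijenhuis_tensor A N \<and>
     (\<forall>p. \<sigma> p o\<^sub>L dual_map (N p) = N p o\<^sub>L \<sigma> p) \<and>
     (\<forall>\<alpha> \<beta>. smooth_form A UNIV \<alpha> \<and> smooth_form A UNIV \<beta> \<longrightarrow>
        (\<forall>p. form_bracket A (twist N \<sigma>) \<alpha> \<beta> p =
               form_bracket A \<sigma> (\<lambda>q. dual_map (N q) (\<alpha> q)) \<beta> p
               + form_bracket A \<sigma> \<alpha> (\<lambda>q. dual_map (N q) (\<beta> q)) p
               - dual_map (N p) (form_bracket A \<sigma> \<alpha> \<beta> p)))"


section \<open>The complexified generalized tangent bundle\<close>

text \<open>Elements of \<open>T\<^sub>pM \<oplus> T\<^sup>*\<^sub>pM\<close> are pairs \<open>(X, \<xi>)\<close>; an element \<open>a + i b\<close> of the complexification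
  of a real vector space is the pair \<open>(a, b)\<close>.\<close>

type_synonym 'e gtan = "'e \<times> 'e dual"
type_synonym 'v cplx = "'v \<times> 'v"

definition cscale :: "complex \<Rightarrow> 'v::real_vector cplx \<Rightarrow> 'v cplx" where
  "cscale z u = (Re z *\<^sub>R fst u - Im z *\<^sub>R snd u, Re z *\<^sub>R snd u + Im z *\<^sub>R fst u)"

definition cconj :: "'v::real_vector cplx \<Rightarrow> 'v cplx" where
  "cconj u = (fst u, - snd u)"

definition pairing :: "'e::real_normed_vector gtan \<Rightarrow> 'e gtan \<Rightarrow> real" where
  "pairing u v = (blinfun_apply (snd u) (fst v) + blinfun_apply (snd v) (fst u)) / 2"

text \<open>The complex bilinear extensions of the pairing and of the Courant-Dorfman bracket.\<close>

definition cpairing :: "'e::real_normed_vector gtan cplx \<Rightarrow> 'e gtan cplx \<Rightarrow> complex" where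
  "cpairing u v = Complex (pairing (fst u) (fst v) - pairing (snd u) (snd v))
                          (pairing (fst u) (snd v) + pairing (snd u) (fst v))"

definition dorfman :: "('a, 'e::real_normed_vector) atlas \<Rightarrow>
    ('a \<Rightarrow> 'e gtan) \<Rightarrow> ('a \<Rightarrow> 'e gtan) \<Rightarrow> 'a \<Rightarrow> 'e gtan" where
  "dorfman A u v p =
     (let X = fst \<circ> u; \<xi> = snd \<circ> u; Y = fst \<circ> v; \<eta> = snd \<circ> v in
       (lie_bracket A X Y p, lie_deriv A X \<eta> p - interior_product Y (ext_deriv A \<xi>) p))"

definition cdorfman :: "('a, 'e::real_normed_vector) atlas \<Rightarrow>
    ('a \<Rightarrow> 'e gtan cplx) \<Rightarrow> ('a \<Rightarrow> 'e gtan cplx) \<Rightarrow> 'a \<Rightarrow> 'e gtan cplx" where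
  "cdorfman A u v p =
     (let a = fst \<circ> u; b = snd \<circ> u; c = fst \<circ> v; d = snd \<circ> v in
       (dorfman A a c p - dorfman A b d p, dorfman A a d p + dorfman A b c p))"

definition smooth_section :: "('a, 'e::real_normed_vector) atlas \<Rightarrow> 'a set \<Rightarrow>
    ('a \<Rightarrow> 'e gtan cplx) \<Rightarrow> bool" where
  "smooth_section A U u \<longleftrightarrow>
     smooth_vec A U (fst \<circ> fst \<circ> u) \<and> smooth_form A U (snd \<circ> fst \<circ> u) \<and>
     smooth_vec A U (fst \<circ> snd \<circ> u) \<and> smooth_form A U (snd \<circ> snd \<circ> u)"


section \<open>Generalized complex structures\<close>

text \<open>A subbundle is given by its fibres \<open>L p\<close>; locally it has a smooth complex frame.\<close>

definition csubbundle :: "('a::topological_space, 'e::real_normed_vector) atlas \<Rightarrow>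
    ('a \<Rightarrow> 'e gtan cplx set) \<Rightarrow> bool" where
  "csubbundle A L \<longleftrightarrow>
     (\<forall>p. \<exists>U (k::nat) e. open U \<and> p \<in> U \<and> (\<forall>i<k. smooth_section A U (e i)) \<and>
        (\<forall>q\<in>U. L q = range (\<lambda>z::nat \<Rightarrow> complex. \<Sum>i<k. cscale (z i) (e i q)) \<and>
           (\<forall>z::nat \<Rightarrow> complex. (\<Sum>i<k. cscale (z i) (e i q)) = 0 \<longrightarrow> (\<forall>i<k. z i = 0))))"

definition lagrangian :: "('a \<Rightarrow> 'e::real_normed_vector gtan cplx set) \<Rightarrow> bool" where
  "lagrangian L \<longleftrightarrow> (\<forall>p. L p = {u. \<forall>v\<in>L p. cpairing u v = 0})"

definition involutive :: "('a, 'e::real_normed_vector) atlas \<Rightarrow>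
    ('a \<Rightarrow> 'e gtan cplx set) \<Rightarrow> bool" where
  "involutive A L \<longleftrightarrow>
     (\<forall>u v. smooth_section A UNIV u \<and> smooth_section A UNIV v \<and>
        (\<forall>p. u p \<in> L p) \<and> (\<forall>p. v p \<in> L p) \<longrightarrow> (\<forall>p. cdorfman A u v p \<in> L p))"

definition generalized_complex :: "('a::topological_space, 'e::real_normed_vector) atlas \<Rightarrow>
    ('a \<Rightarrow> 'e gtan cplx set) \<Rightarrow> bool" where
  "generalized_complex A L \<longleftrightarrow>
     csubbundle A L \<and> lagrangian L \<and> involutive A L \<and> (\<forall>p. L p \<inter> cconj ` L p = {0})"

text \<open>\<open>L = {v + i J v}\<close>; this determines \<open>J\<close>.\<close>

definition associated_map ::
    "('a \<Rightarrow> 'e::real_normed_vector gtan cplx set) \<Rightarrow> ('a \<Rightarrow> 'e gtan \<Rightarrow> 'e gtan) \<Rightarrow> bool" where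
  "associated_map L J \<longleftrightarrow> (\<forall>p. L p = {(v, J p v) | v. True})"

text \<open>A complex bivector \<open>P + i Q\<close> is the pair \<open>(P, Q)\<close> at each point.\<close>

definition csharp :: "('e dual \<Rightarrow>\<^sub>L 'e) cplx \<Rightarrow> 'e::real_normed_vector dual cplx \<Rightarrow> 'e cplx" where
  "csharp \<pi> \<alpha> = (fst \<pi> (fst \<alpha>) - snd \<pi> (snd \<alpha>), fst \<pi> (snd \<alpha>) + snd \<pi> (fst \<alpha>))"

definition bivector_graph ::
    "('a \<Rightarrow> ('e dual \<Rightarrow>\<^sub>L 'e) cplx) \<Rightarrow> 'a \<Rightarrow> 'e::real_normed_vector gtan cplx set" where
  "bivector_graph \<pi> p =
     {((fst (csharp (\<pi> p) \<alpha>), fst \<alpha>), (snd (csharp (\<pi> p) \<alpha>), snd \<alpha>)) | \<alpha>. True}"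

definition block_map :: "('v \<Rightarrow> 'v) \<Rightarrow> ('w \<Rightarrow> 'v) \<Rightarrow> ('v \<Rightarrow> 'w) \<Rightarrow> ('w \<Rightarrow> 'w) \<Rightarrow>
    'v::plus \<times> 'w::plus \<Rightarrow> 'v \<times> 'w" where
  "block_map a b c d u = (a (fst u) + b (snd u), c (fst u) + d (snd u))"

end

theory Submission
  imports Defs
begin

text \<open>
  For a complex bivector \<open>\<pi>\<close> one has \<open>[\<pi>\<^sup>\<sharp>\<alpha> + \<alpha>, \<pi>\<^sup>\<sharp>\<beta> + \<beta>] = [\<pi>\<^sup>\<sharp>\<alpha>, \<pi>\<^sup>\<sharp>\<beta>] + [\<alpha>, \<beta>]\<^sub>\<pi>\<close>, so
  involutivity of the graph means \<open>\<pi>\<^sup>\<sharp>[\<alpha>, \<beta>]\<^sub>\<pi> = [\<pi>\<^sup>\<sharp>\<alpha>, \<pi>\<^sup>\<sharp>\<beta>]\<close>.  For \<open>\<sigma>\<close> this is the Jacobi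
  identity on coordinate functions.  For \<open>\<pi> = \<sigma>\<^sub>N + i \<sigma>\<close>, put \<open>X = \<sigma>\<^sup>\<sharp>\<alpha>\<close> and \<open>Y = \<sigma>\<^sup>\<sharp>\<beta>\<close>; applying
  \<open>\<sigma>\<^sup>\<sharp>\<close> to the compatibility condition gives
  \<open>\<sigma>\<^sup>\<sharp>[\<alpha>, \<beta>]\<^bsub>\<sigma>\<^sub>N\<^esub> = [N X, Y] + [X, N Y] - N [X, Y]\<close>, which is the imaginary part, and applying \<open>N\<close>
  once more and using that the torsion of \<open>N\<close> vanishes gives the real part.  All compatibility
  conditions are only used on the one-forms that occur in the given global sections, so no cut-off
  functions are needed.
\<close>

section \<open>Smooth maps\<close>

lemma has_derivative_fderiv:
  "f differentiable (at x) \<Longrightarrow> (f has_derivative blinfun_apply (fderiv f x)) (at x)"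
  unfolding fderiv_def
  by (metis bounded_linear_Blinfun_apply frechet_derivative_works has_derivative_bounded_linear)

lemma frechet_derivative_eqI:
  "(f has_derivative D) (at x) \<Longrightarrow> frechet_derivative f (at x) = D"
  by (rule frechet_derivative_at[symmetric])

lemma fderiv_eqI:
  assumes "(f has_derivative blinfun_apply D) (at x)"
  shows "fderiv f x = D"
  unfolding fderiv_def by (simp add: frechet_derivative_eqI[OF assms] blinfun_apply_inverse)

lemma frechet_derivative_fderiv:
  "f differentiable (at x) \<Longrightarrow> frechet_derivative f (at x) = blinfun_apply (fderiv f x)"
  by (rule frechet_derivative_eqI[OF has_derivative_fderiv])

lemma fderiv_apply_eqI:
  assumes "(f has_derivative D) (at x)"
  shows "fderiv f x w = D w"
proof -
  have "f differentiable (at x)" using assms by (auto simp: differentiable_def)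
  from frechet_derivative_fderiv[OF this] frechet_derivative_eqI[OF assms] show ?thesis by simp
qed

lemma differentiable_cong_open:
  assumes "f differentiable (at x)" "open S" "x \<in> S" "\<And>y. y \<in> S \<Longrightarrow> f y = g y"
  shows "g differentiable (at x)"
  using assms unfolding differentiable_def
  by (metis has_derivative_transform_within_open)

lemma frechet_derivative_cong_open:
  assumes "f differentiable (at x)" "open S" "x \<in> S" "\<And>y. y \<in> S \<Longrightarrow> f y = g y"
  shows "frechet_derivative g (at x) = frechet_derivative f (at x)"
  using assms
  by (metis frechet_derivative_at frechet_derivative_works has_derivative_transform_within_open)

text \<open>Since \<open>S\<close> is open, maps that agree on \<open>S\<close> have equal
  derivatives at its points, so the induction passes to the directional derivatives. Every later
  change of representation rests on this.\<close>

lemma times_diff_on_cong: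
  assumes "open S" "\<And>x. x \<in> S \<Longrightarrow> f x = g x" "times_diff_on n S f"
  shows "times_diff_on n S g"
  using assms(2,3)
proof (induction n arbitrary: f g)
  case 0
  then show ?case by (simp cong: continuous_on_cong)
next
  case (Suc n)
  have "g differentiable (at x)" if "x \<in> S" for x
    by (rule differentiable_cong_open[where f = f, OF _ \<open>open S\<close> that]) (use Suc.prems that in auto)
  moreover have "times_diff_on n S (\<lambda>x. frechet_derivative g (at x) v)" for v
  proof (rule Suc.IH)
    show "times_diff_on n S (\<lambda>x. frechet_derivative f (at x) v)" using Suc.prems by simp
    show "frechet_derivative f (at x) v = frechet_derivative g (at x) v" if "x \<in> S" for x
      using frechet_derivative_cong_open[where f = f and g = g, OF _ \<open>open S\<close> that] Suc.prems that
      by auto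
  qed
  ultimately show ?case by simp
qed

text \<open>Each term of the Leibniz rule keeps one factor undifferentiated, and the induction
  hypothesis needs this factor at the lower order.\<close>

lemma times_diff_on_pred: "times_diff_on (Suc n) S f \<Longrightarrow> times_diff_on n S f"
proof (induction n arbitrary: f)
  case 0
  then show ?case
    by (simp add: continuous_at_imp_continuous_on differentiable_imp_continuous_within)
qed auto

lemma times_diff_on_const: "times_diff_on n S (\<lambda>x. c)"
  by (induction n arbitrary: c) auto

lemma times_diff_on_add:
  assumes "open S" "times_diff_on n S f" "times_diff_on n S g"
  shows "times_diff_on n S (\<lambda>x. f x + g x)"
  using assms(2,3)
proof (induction n arbitrary: f g)
  case 0
  then show ?case by (simp add: continuous_on_add)
next
  case (Suc n)
  have "times_diff_on n S (\<lambda>x. frechet_derivative (\<lambda>x. f x + g x) (at x) v)" for v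
  proof (rule times_diff_on_cong[OF \<open>open S\<close>])
    show "times_diff_on n S
      (\<lambda>x. frechet_derivative f (at x) v + frechet_derivative g (at x) v)"
      using Suc by simp
    show "frechet_derivative f (at x) v + frechet_derivative g (at x) v =
        frechet_derivative (\<lambda>x. f x + g x) (at x) v" if "x \<in> S" for x
    proof -
      have "((\<lambda>x. f x + g x) has_derivative
          (\<lambda>v. frechet_derivative f (at x) v + frechet_derivative g (at x) v)) (at x)"
        using Suc.prems that by (intro has_derivative_add iffD1[OF frechet_derivative_works]) auto
      then show ?thesis by (simp add: frechet_derivative_eqI)
    qed
  qed
  with Suc.prems show ?case by simp
qed

lemma times_diff_on_bounded_linear:
  assumes "open S" "bounded_linear T" "times_diff_on n S f"
  shows "times_diff_on n S (\<lambda>x. T (f x))"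
  using assms(3)
proof (induction n arbitrary: f)
  case 0
  then show ?case by (simp add: bounded_linear.continuous_on[OF assms(2)])
next
  case (Suc n)
  have der: "((\<lambda>x. T (f x)) has_derivative (\<lambda>v. T (frechet_derivative f (at x) v))) (at x)"
    if "x \<in> S" for x
    using Suc.prems that
    by (intro bounded_linear.has_derivative[OF assms(2)] iffD1[OF frechet_derivative_works]) auto
  have "times_diff_on n S (\<lambda>x. frechet_derivative (\<lambda>x. T (f x)) (at x) v)" for v
  proof (rule times_diff_on_cong[OF \<open>open S\<close>])
    show "times_diff_on n S (\<lambda>x. T (frechet_derivative f (at x) v))"
      using Suc by simp
  qed (simp add: frechet_derivative_eqI[OF der])
  moreover have "(\<lambda>x. T (f x)) differentiable (at x)" if "x \<in> S" for x
    using der[OF that] differentiable_def by blast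
  ultimately show ?case by simp
qed

text \<open>Both terms of the Leibniz rule are again of the form \<open>B (f x) (g x)\<close>, so
  induction closes with \<open>f\<close> and \<open>g\<close> arbitrary. Application and composition
  of bounded linear maps are instances, which covers all contractions of tensors below.\<close>

lemma times_diff_on_bounded_bilinear:
  assumes "open S" "bounded_bilinear B" "times_diff_on n S f" "times_diff_on n S g"
  shows "times_diff_on n S (\<lambda>x. B (f x) (g x))"
  using assms(3,4)
proof (induction n arbitrary: f g)
  case 0
  then show ?case by (simp add: bounded_bilinear.continuous_on[OF assms(2)])
next
  case (Suc n)
  have der: "((\<lambda>x. B (f x) (g x)) has_derivative
      (\<lambda>v. B (f x) (frechet_derivative g (at x) v) + B (frechet_derivative f (at x) v) (g x)))
      (at x)" if "x \<in> S" for x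
    using Suc.prems that
    by (intro bounded_bilinear.FDERIV[OF assms(2)] iffD1[OF frechet_derivative_works]) auto
  have "times_diff_on n S (\<lambda>x. frechet_derivative (\<lambda>x. B (f x) (g x)) (at x) v)" for v
  proof (rule times_diff_on_cong[OF \<open>open S\<close>])
    show "times_diff_on n S (\<lambda>x. B (f x) (frechet_derivative g (at x) v) +
        B (frechet_derivative f (at x) v) (g x))"
      using Suc.prems Suc.prems[THEN times_diff_on_pred]
      by (intro times_diff_on_add[OF \<open>open S\<close>] Suc.IH) auto
  qed (simp add: frechet_derivative_eqI[OF der])
  moreover have "(\<lambda>x. B (f x) (g x)) differentiable (at x)" if "x \<in> S" for x
    using der[OF that] differentiable_def by blast
  ultimately show ?case by simp
qed

section \<open>Closure properties of smooth maps\<close>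

lemma smooth_on_imp_differentiable:
  assumes "smooth_on S f" "x \<in> S"
  shows "f differentiable (at x)"
proof -
  have "times_diff_on (Suc 0) S f" using assms(1) by (simp only: smooth_on_def)
  with assms(2) show ?thesis by simp
qed

lemma smooth_on_cong:
  "open S \<Longrightarrow> (\<And>x. x \<in> S \<Longrightarrow> f x = g x) \<Longrightarrow> smooth_on S f \<Longrightarrow> smooth_on S g"
  unfolding smooth_on_def by (metis times_diff_on_cong)

lemma smooth_on_const: "smooth_on S (\<lambda>x. c)"
  by (simp add: smooth_on_def times_diff_on_const)

lemma smooth_on_subset:
  assumes "smooth_on S f" "T \<subseteq> S"
  shows "smooth_on T f"
  unfolding smooth_on_def
proof
  fix n
  have "times_diff_on n S f" using assms(1) by (simp add: smooth_on_def)
  then show "times_diff_on n T f"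
    by (induction n arbitrary: f) (use assms(2) continuous_on_subset in \<open>auto dest: subsetD\<close>)
qed

lemma smooth_on_add:
  "open S \<Longrightarrow> smooth_on S f \<Longrightarrow> smooth_on S g \<Longrightarrow> smooth_on S (\<lambda>x. f x + g x)"
  by (simp add: smooth_on_def times_diff_on_add)

lemma smooth_on_sum:
  "open S \<Longrightarrow> (\<And>i. i \<in> I \<Longrightarrow> smooth_on S (f i)) \<Longrightarrow> smooth_on S (\<lambda>x. \<Sum>i\<in>I. f i x)"
  by (induction I rule: infinite_finite_induct) (auto intro: smooth_on_const smooth_on_add)

lemma smooth_on_bounded_linear:
  "open S \<Longrightarrow> bounded_linear T \<Longrightarrow> smooth_on S f \<Longrightarrow> smooth_on S (\<lambda>x. T (f x))"
  by (simp add: smooth_on_def times_diff_on_bounded_linear)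

lemma smooth_on_bounded_bilinear:
  "open S \<Longrightarrow> bounded_bilinear B \<Longrightarrow> smooth_on S f \<Longrightarrow> smooth_on S g \<Longrightarrow>
    smooth_on S (\<lambda>x. B (f x) (g x))"
  by (simp add: smooth_on_def times_diff_on_bounded_bilinear)

lemma smooth_on_frechet_derivative:
  assumes "smooth_on S f"
  shows "smooth_on S (\<lambda>x. frechet_derivative f (at x) v)"
  unfolding smooth_on_def
proof
  fix n
  have "times_diff_on (Suc n) S f" using assms by (simp only: smooth_on_def)
  then show "times_diff_on n S (\<lambda>x. frechet_derivative f (at x) v)" by simp
qed

text \<open>The model space is only a \<open>real_inner\<close> type spanned by a finite set, so
  this takes the place of \<open>Basis\<close>. Spanning is stated as the expansion formula, the
  form in which it is used; the empty set serves in dimension 0.\<close>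

definition orthonormal_basis :: "'e::real_inner set \<Rightarrow> bool" where
  "orthonormal_basis B \<longleftrightarrow> finite B \<and> (\<forall>b\<in>B. \<forall>b'\<in>B. b \<bullet> b' = (if b = b' then 1 else 0)) \<and>
     (\<forall>v. v = (\<Sum>b\<in>B. (v \<bullet> b) *\<^sub>R b))"

lemma orthonormal_basis_exists:
  fixes B :: "'e::real_inner set"
  assumes "finite B" "span B = UNIV"
  obtains C :: "'e set" where "orthonormal_basis C"
proof -
  obtain D where D: "finite D" "span D = (UNIV::'e set)" "pairwise orthogonal D"
    using basis_orthogonal[OF assms(1)] assms(2) by metis
  \<comment> \<open>The orthogonal family may contain 0, which has to go before normalising.\<close>
  define C where "C = (\<lambda>d. d /\<^sub>R norm d) ` (D - {0})"
  have fin: "finite C" using D(1) by (simp add: C_def)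
  have on: "b \<bullet> b' = (if b = b' then 1 else 0)" if bb: "b \<in> C" "b' \<in> C" for b b'
  proof -
    obtain d d' where d: "d \<in> D" "d \<noteq> 0" "b = d /\<^sub>R norm d" "d' \<in> D" "d' \<noteq> 0" "b' = d' /\<^sub>R norm d'"
      using bb by (auto simp: C_def)
    have 1: "b \<bullet> b = 1" using d by (simp add: dot_square_norm power2_eq_square)
    have "b \<bullet> b' = 0" if "b \<noteq> b'"
    proof -
      have "d \<noteq> d'" using that d by auto
      then have "d \<bullet> d' = 0" using D(3) d unfolding pairwise_def orthogonal_def by blast
      then show ?thesis using d by simp
    qed
    with 1 show ?thesis by auto
  qed
  have "D \<subseteq> span C"
  proof
    fix d assume "d \<in> D"
    show "d \<in> span C"
    proof (cases "d = 0")
      case False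
      then have "d /\<^sub>R norm d \<in> C" using \<open>d \<in> D\<close> by (auto simp: C_def)
      then have "norm d *\<^sub>R (d /\<^sub>R norm d) \<in> span C" by (intro span_scale span_base)
      with False show ?thesis by simp
    qed (simp add: span_zero)
  qed
  then have "span C = UNIV" using D(2) span_minimal[of D "span C"] by (auto simp: subspace_span)
  have ex: "v = (\<Sum>b\<in>C. (v \<bullet> b) *\<^sub>R b)" for v
  proof -
    have "v \<in> span C" using \<open>span C = UNIV\<close> by simp
    then show ?thesis
    proof (induction rule: span_induct_alt)
      case base
      show ?case by simp
    next
      case (step c x y)
      \<comment> \<open>A single basis vector \<open>x\<close> is its own expansion: by
        orthonormality only the term \<open>b = x\<close> survives.\<close>
      have "(\<Sum>b\<in>C. (x \<bullet> b) *\<^sub>R b) = (\<Sum>b\<in>C. if b = x then x else 0)"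
        using on step(1) by (intro sum.cong) auto
      also have "\<dots> = x" using fin step(1) by simp
      finally have "(\<Sum>b\<in>C. (c *\<^sub>R x \<bullet> b) *\<^sub>R b) = c *\<^sub>R x"
        by (simp flip: scaleR_scaleR scaleR_sum_right)
      with step(2) show ?case
        by (simp add: inner_add_left scaleR_left_distrib sum.distrib del: inner_scaleR_left)
    qed
  qed
  have "orthonormal_basis C" unfolding orthonormal_basis_def by (intro conjI ballI allI fin on ex)
  then show ?thesis by (rule that)
qed

lemma linear_orthonormal_basis_expansion:
  assumes "orthonormal_basis B" "linear f"
  shows "f v = (\<Sum>b\<in>B. (v \<bullet> b) *\<^sub>R f b)"
proof -
  have "v = (\<Sum>b\<in>B. (v \<bullet> b) *\<^sub>R b)"
    using assms(1) unfolding orthonormal_basis_def by (elim conjE allE)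
  then have "f v = f (\<Sum>b\<in>B. (v \<bullet> b) *\<^sub>R b)" by (rule arg_cong)
  also have "\<dots> = (\<Sum>b\<in>B. (v \<bullet> b) *\<^sub>R f b)"
    by (simp add: linear_sum[OF assms(2)] linear_scale[OF assms(2)])
  finally show ?thesis .
qed

lemma orthonormal_basis_blinfun_expansion:
  fixes \<xi> :: "'e::real_inner \<Rightarrow>\<^sub>L 'f::real_normed_vector"
  assumes "orthonormal_basis B"
  shows "\<xi> v = (\<Sum>b\<in>B. (v \<bullet> b) *\<^sub>R \<xi> b)"
  by (rule linear_orthonormal_basis_expansion[OF assms])
    (simp add: blinfun.bounded_linear_right bounded_linear.linear)

text \<open>\<open>smooth_on\<close> controls only the directional derivatives for fixed vectors.
  The operator-valued derivative is the finite sum over the basis of the rank-one maps taking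
  \<open>v\<close> to \<open>(v \<bullet> b)\<close> times the derivative along \<open>b\<close>,
  and each summand is a bounded linear image of a smooth map.\<close>

lemma smooth_on_fderiv:
  fixes B :: "'e::real_inner set" and f :: "'e \<Rightarrow> 'f::real_normed_vector"
  assumes "orthonormal_basis B" "open S" "smooth_on S f"
  shows "smooth_on S (fderiv f)"
proof (rule smooth_on_cong[OF \<open>open S\<close>])
  let ?T = "\<lambda>b y. blinfun_scaleR_left y o\<^sub>L blinfun_inner_left b"
  show "smooth_on S (\<lambda>x. \<Sum>b\<in>B. ?T b (frechet_derivative f (at x) b))"
  proof (rule smooth_on_sum[OF \<open>open S\<close>])
    fix b :: 'e
    have "bounded_linear (?T b)"
      by (rule bounded_linear_compose[OF bounded_bilinear.bounded_linear_left[OF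
        bounded_bilinear_blinfun_compose] bounded_linear_blinfun_scaleR_left])
    then show "smooth_on S (\<lambda>x. ?T b (frechet_derivative f (at x) b))"
      by (rule smooth_on_bounded_linear[OF \<open>open S\<close> _
        smooth_on_frechet_derivative[OF \<open>smooth_on S f\<close>]])
  qed
  show "(\<Sum>b\<in>B. ?T b (frechet_derivative f (at x) b)) = fderiv f x" if "x \<in> S" for x
  proof (rule blinfun_eqI)
    fix v
    have "frechet_derivative f (at x) = blinfun_apply (fderiv f x)"
      by (rule frechet_derivative_fderiv[OF smooth_on_imp_differentiable[OF assms(3) that]])
    then have "(\<Sum>b\<in>B. ?T b (frechet_derivative f (at x) b)) v
        = (\<Sum>b\<in>B. (v \<bullet> b) *\<^sub>R fderiv f x b)"
      by (simp add: blinfun.sum_left inner_commute)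
    also have "\<dots> = fderiv f x v"
      by (rule orthonormal_basis_blinfun_expansion[OF assms(1), symmetric])
    finally show "(\<Sum>b\<in>B. ?T b (frechet_derivative f (at x) b)) v = fderiv f x v" .
  qed
qed

section \<open>Charts and components\<close>

lemma blinfun_apply_compose:
  "blinfun_apply (S o\<^sub>L T) = blinfun_apply S \<circ> blinfun_apply T"
  by (simp add: fun_eq_iff)

lemma blinfun_compose_assoc: "(S o\<^sub>L T) o\<^sub>L R = S o\<^sub>L (T o\<^sub>L R)"
  by (rule blinfun_eqI) simp

lemma dual_map_apply [simp]:
  fixes \<xi> :: "'f::real_normed_vector dual"
  shows "dual_map T \<xi> = \<xi> o\<^sub>L T"
proof -
  have "bounded_linear (\<lambda>\<xi> :: 'f dual. \<xi> o\<^sub>L T)"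
    by (rule bounded_bilinear.bounded_linear_left[OF bounded_bilinear_blinfun_compose])
  then show ?thesis unfolding dual_map_def by (simp add: bounded_linear_Blinfun_apply)
qed

text \<open>The inner product supplies enough covectors: pairing with \<open>v - w\<close> itself
  shows that its norm vanishes.\<close>

lemma blinfun_separation:
  fixes v w :: "'e::real_inner"
  assumes "\<And>\<gamma> :: 'e dual. blinfun_apply \<gamma> v = blinfun_apply \<gamma> w"
  shows "v = w"
proof -
  have "(v - w) \<bullet> v = (v - w) \<bullet> w" using assms[of "blinfun_inner_right (v - w)"] by simp
  then have "(v - w) \<bullet> (v - w) = 0" by (simp add: inner_diff_right)
  then show ?thesis by simp
qed

locale smooth_atlas =
  fixes A :: "('a::{t2_space, second_countable_topology}, 'e::real_inner) atlas"
  assumes smooth_manifold: "smooth_manifold A"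
begin

section \<open>Charts and their transition maps\<close>

lemma orthonormal_basis_model:
  obtains B :: "'e set" where "orthonormal_basis B"
  using smooth_manifold orthonormal_basis_exists unfolding smooth_manifold_def by metis

lemma chart_at_mem: "chart_at A p \<in> A" "p \<in> cdom (chart_at A p)"
proof -
  have "p \<in> (\<Union>c\<in>A. cdom c)" using smooth_manifold by (auto simp: smooth_manifold_def)
  then have "\<exists>c. c \<in> A \<and> p \<in> cdom c" by blast
  then show "chart_at A p \<in> A" "p \<in> cdom (chart_at A p)"
    unfolding chart_at_def by (metis (mono_tags, lifting) someI_ex)+
qed

lemma open_cdom: "c \<in> A \<Longrightarrow> open (cdom c)"
  using smooth_manifold by (auto simp: smooth_manifold_def)

lemma homeomorphism_chart:
  "c \<in> A \<Longrightarrow> homeomorphism (cdom c) (cmap c ` cdom c) (cmap c) (cinv c)"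
  using smooth_manifold by (auto simp: smooth_manifold_def)

lemma open_cmap_image:
  assumes "c \<in> A" "open U"
  shows "open (cmap c ` (cdom c \<inter> U))"
proof -
  have "continuous_on (cmap c ` cdom c) (cinv c)" "open (cmap c ` cdom c)"
    using homeomorphism_chart[OF assms(1)] smooth_manifold assms(1)
    by (auto simp: homeomorphism_def smooth_manifold_def)
  then have "open ((cmap c ` cdom c) \<inter> cinv c -` U)"
    using assms(2) by (rule continuous_open_preimage)
  also have "(cmap c ` cdom c) \<inter> cinv c -` U = cmap c ` (cdom c \<inter> U)"
    using homeomorphism_chart[OF assms(1)] by (auto simp: homeomorphism_def)
  finally show ?thesis .
qed

lemma open_cmap_cdom: "c \<in> A \<Longrightarrow> open (cmap c ` cdom c)"
  using open_cmap_image[of c UNIV] by simp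

lemma cinv_cmap: "c \<in> A \<Longrightarrow> p \<in> cdom c \<Longrightarrow> cinv c (cmap c p) = p"
  using homeomorphism_chart by (simp add: homeomorphism_def)

lemma cinv_mem: "c \<in> A \<Longrightarrow> x \<in> cmap c ` cdom c \<Longrightarrow> cinv c x \<in> cdom c"
  by (metis cinv_cmap imageE)

lemma cmap_cinv: "c \<in> A \<Longrightarrow> x \<in> cmap c ` cdom c \<Longrightarrow> cmap c (cinv c x) = x"
  by (metis cinv_cmap imageE)

lemma smooth_on_transition:
  "c \<in> A \<Longrightarrow> d \<in> A \<Longrightarrow> smooth_on (cmap d ` (cdom d \<inter> cdom c)) (cmap c \<circ> cinv d)"
  using smooth_manifold unfolding smooth_manifold_def by blast

lemma transition_has_derivative:
  assumes "c \<in> A" "d \<in> A" "p \<in> cdom c" "p \<in> cdom d"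
  shows "((cmap c \<circ> cinv d) has_derivative fderiv (cmap c \<circ> cinv d) (cmap d p)) (at (cmap d p))"
  using assms
  by (intro has_derivative_fderiv smooth_on_imp_differentiable[OF smooth_on_transition]) auto

text \<open>This is the chain rule. The middle chart cancels only over the overlap of
  \<open>d\<close> and \<open>e\<close>, whose image under \<open>e\<close> is an open neighbourhood
  of the point. With \<open>c = e\<close> it shows that \<open>to_chart\<close> and
  \<open>from_chart\<close> are mutually inverse.\<close>

lemma fderiv_transition_compose:
  assumes "c \<in> A" "d \<in> A" "e \<in> A" "p \<in> cdom c" "p \<in> cdom d" "p \<in> cdom e"
  shows "fderiv (cmap c \<circ> cinv d) (cmap d p) o\<^sub>L fderiv (cmap d \<circ> cinv e) (cmap e p) =
    fderiv (cmap c \<circ> cinv e) (cmap e p)"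
proof (rule fderiv_eqI[symmetric])
  have *: "(cmap d \<circ> cinv e) (cmap e p) = cmap d p" using assms by (simp add: cinv_cmap)
  have "((cmap c \<circ> cinv d) \<circ> (cmap d \<circ> cinv e) has_derivative
      fderiv (cmap c \<circ> cinv d) (cmap d p) \<circ> fderiv (cmap d \<circ> cinv e) (cmap e p)) (at (cmap e p))"
    using transition_has_derivative[of c d p] transition_has_derivative[of d e p] assms *
    by (intro diff_chain_at) simp_all
  then show "(cmap c \<circ> cinv e has_derivative
      blinfun_apply (fderiv (cmap c \<circ> cinv d) (cmap d p) o\<^sub>L fderiv (cmap d \<circ> cinv e) (cmap e p)))
      (at (cmap e p))"
    unfolding blinfun_apply_compose
  proof (rule has_derivative_transform_within_open)
    show "open (cmap e ` (cdom e \<inter> cdom d))" using assms open_cmap_image open_cdom by blast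
    show "cmap e p \<in> cmap e ` (cdom e \<inter> cdom d)" using assms by blast
    show "((cmap c \<circ> cinv d) \<circ> (cmap d \<circ> cinv e)) x = (cmap c \<circ> cinv e) x"
      if "x \<in> cmap e ` (cdom e \<inter> cdom d)" for x
      using that assms by (auto simp: cinv_cmap)
  qed
qed

lemma fderiv_transition_id:
  assumes "c \<in> A" "p \<in> cdom c"
  shows "fderiv (cmap c \<circ> cinv c) (cmap c p) = id_blinfun"
proof (rule fderiv_eqI)
  have "((\<lambda>x. x) has_derivative blinfun_apply id_blinfun) (at (cmap c p))"
    by (simp add: id_blinfun.rep_eq)
  then show "(cmap c \<circ> cinv c has_derivative blinfun_apply id_blinfun) (at (cmap c p))"
    by (rule has_derivative_transform_within_open[OF _ open_cmap_cdom[OF assms(1)]])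
      (use assms cmap_cinv in auto)
qed

lemma to_chart_from_chart:
  "c \<in> A \<Longrightarrow> p \<in> cdom c \<Longrightarrow> to_chart A c p o\<^sub>L from_chart A c p = id_blinfun"
  unfolding to_chart_def from_chart_def
  using fderiv_transition_compose chart_at_mem fderiv_transition_id by simp

lemma from_chart_to_chart:
  "c \<in> A \<Longrightarrow> p \<in> cdom c \<Longrightarrow> from_chart A c p o\<^sub>L to_chart A c p = id_blinfun"
  unfolding to_chart_def from_chart_def
  using fderiv_transition_compose chart_at_mem fderiv_transition_id by simp

lemma to_chart_from_chart_apply [simp]:
  "c \<in> A \<Longrightarrow> p \<in> cdom c \<Longrightarrow> to_chart A c p (from_chart A c p v) = v"
  using arg_cong[OF to_chart_from_chart, of c p "\<lambda>T. blinfun_apply T v"] by simp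

lemma from_chart_to_chart_apply [simp]:
  "c \<in> A \<Longrightarrow> p \<in> cdom c \<Longrightarrow> from_chart A c p (to_chart A c p v) = v"
  using arg_cong[OF from_chart_to_chart, of c p "\<lambda>T. blinfun_apply T v"] by simp

lemma to_chart_at [simp]: "to_chart A (chart_at A p) p = id_blinfun"
  unfolding to_chart_def using fderiv_transition_id chart_at_mem by simp

lemma from_chart_at [simp]: "from_chart A (chart_at A p) p = id_blinfun"
  unfolding from_chart_def using fderiv_transition_id chart_at_mem by simp

text \<open>Taking components commutes with contraction because adjacent factors
  \<open>from_chart\<close> and \<open>to_chart\<close> cancel at points of the chart domain. The
  same holds in the next three lemmas; together they turn operations on fields into bilinear
  expressions in components.\<close>

lemma vec_rep_sharp:
  fixes P :: "'a \<Rightarrow> 'e dual \<Rightarrow>\<^sub>L 'e"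
  assumes "c \<in> A" "x \<in> cmap c ` cdom c"
  shows "vec_rep A c (\<lambda>q. P q (\<alpha> q)) x = sharp_rep A c P x (form_rep A c \<alpha> x)"
proof -
  have "\<alpha> (cinv c x) o\<^sub>L from_chart A c (cinv c x) o\<^sub>L to_chart A c (cinv c x) = \<alpha> (cinv c x)"
    using assms cinv_mem by (intro blinfun_eqI) simp
  then show ?thesis by (simp add: vec_rep_def sharp_rep_def form_rep_def Let_def)
qed

lemma form_rep_dual_map:
  fixes N :: "'a \<Rightarrow> 'e \<Rightarrow>\<^sub>L 'e"
  assumes "c \<in> A" "x \<in> cmap c ` cdom c"
  shows "form_rep A c (\<lambda>q. dual_map (N q) (\<alpha> q)) x = form_rep A c \<alpha> x o\<^sub>L endo_rep A c N x"
  using assms cinv_mem by (intro blinfun_eqI) (simp add: form_rep_def endo_rep_def Let_def)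

lemma sharp_rep_twist:
  assumes "c \<in> A" "x \<in> cmap c ` cdom c"
  shows "sharp_rep A c (twist N P) x = endo_rep A c N x o\<^sub>L sharp_rep A c P x"
  using assms cinv_mem
  by (intro blinfun_eqI) (simp add: sharp_rep_def endo_rep_def Let_def twist_def)

lemma fun_rep_pairing:
  assumes "c \<in> A" "x \<in> cmap c ` cdom c"
  shows "fun_rep c (\<lambda>q. blinfun_apply (\<beta> q) (X q)) x = form_rep A c \<beta> x (vec_rep A c X x)"
  using assms cinv_mem by (simp add: fun_rep_def form_rep_def vec_rep_def Let_def)

lemma vec_rep_chart_at [simp]: "vec_rep A (chart_at A p) X (cmap (chart_at A p) p) = X p"
  using chart_at_mem by (simp add: vec_rep_def cinv_cmap Let_def id_blinfun.rep_eq)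

lemma form_rep_chart_at [simp]: "form_rep A (chart_at A p) \<alpha> (cmap (chart_at A p) p) = \<alpha> p"
  using chart_at_mem by (intro blinfun_eqI) (simp add: form_rep_def cinv_cmap Let_def)

lemma sharp_rep_chart_at [simp]: "sharp_rep A (chart_at A p) P (cmap (chart_at A p) p) = P p"
proof (rule blinfun_eqI)
  fix \<xi> :: "'e dual"
  have "\<xi> o\<^sub>L id_blinfun = \<xi>" by (intro blinfun_eqI) simp
  then show "sharp_rep A (chart_at A p) P (cmap (chart_at A p) p) \<xi> = P p \<xi>"
    using chart_at_mem by (simp add: sharp_rep_def cinv_cmap Let_def)
qed

section \<open>Smooth contractions and coordinate one-forms\<close>

lemma smooth_vec_sharp:
  fixes P :: "'a \<Rightarrow> 'e dual \<Rightarrow>\<^sub>L 'e"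
  assumes "bivector A P" "smooth_form A U \<alpha>" "open U"
  shows "smooth_vec A U (\<lambda>q. P q (\<alpha> q))"
  unfolding smooth_vec_def
proof
  fix c assume c: "c \<in> A"
  note op = open_cmap_image[OF c \<open>open U\<close>]
  have sub: "cmap c ` (cdom c \<inter> U) \<subseteq> cmap c ` cdom c" by blast
  have "smooth_on (cmap c ` (cdom c \<inter> U)) (\<lambda>x. sharp_rep A c P x (form_rep A c \<alpha> x))"
  proof (rule smooth_on_bounded_bilinear[OF op bounded_bilinear_blinfun_apply])
    show "smooth_on (cmap c ` (cdom c \<inter> U)) (sharp_rep A c P)"
      using assms(1) c by (intro smooth_on_subset[OF _ sub]) (simp add: bivector_def)
    show "smooth_on (cmap c ` (cdom c \<inter> U)) (form_rep A c \<alpha>)"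
      using assms(2) c by (simp add: smooth_form_def)
  qed
  then show "smooth_on (cmap c ` (cdom c \<inter> U)) (vec_rep A c (\<lambda>q. P q (\<alpha> q)))"
    by (rule smooth_on_cong[OF op, rotated]) (use vec_rep_sharp[OF c] sub in auto)
qed

text \<open>For skewness, move \<open>N\<close> onto \<beta> as its transpose, use that
  \<open>P\<close> is skew, and return by the commutation hypothesis.\<close>

lemma bivector_twist:
  assumes "bivector A P" "smooth_endo A N" "\<And>p \<xi>. P p (dual_map (N p) \<xi>) = N p (P p \<xi>)"
  shows "bivector A (twist N P)"
  unfolding bivector_def
proof (intro conjI allI ballI)
  fix p and \<alpha> \<beta> :: "'e dual"
  have skew: "blinfun_apply \<zeta> (P p \<xi>) = - blinfun_apply \<xi> (P p \<zeta>)" for \<zeta> \<xi>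
    using assms(1) unfolding bivector_def by blast
  show "blinfun_apply \<beta> (twist N P p \<alpha>) = - blinfun_apply \<alpha> (twist N P p \<beta>)"
    using skew[of "dual_map (N p) \<beta>" \<alpha>] assms(3)[of p \<beta>] by (simp add: twist_def)
next
  fix c assume c: "c \<in> A"
  note op = open_cmap_cdom[OF c]
  have "smooth_on (cmap c ` cdom c) (\<lambda>x. endo_rep A c N x o\<^sub>L sharp_rep A c P x)"
    using assms(1,2) c
    by (intro smooth_on_bounded_bilinear[OF op bounded_bilinear_blinfun_compose])
      (simp_all add: bivector_def smooth_endo_def)
  then show "smooth_on (cmap c ` cdom c) (sharp_rep A c (twist N P))"
    by (rule smooth_on_cong[OF op, rotated]) (simp add: sharp_rep_twist[OF c])
qed

text \<open>A linear form \<xi> composed with a chart plays the role of a coordinate function. The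
  chain rule for the transition to the preferred chart shows that its differential has the constant
  component \<xi> in the chart \<open>c\<close>.\<close>

lemma differential_coordinate:
  assumes "c \<in> A" "q \<in> cdom c"
  shows "differential A (\<lambda>q. blinfun_apply \<xi> (cmap c q)) q = \<xi> o\<^sub>L to_chart A c q"
proof -
  let ?d = "chart_at A q"
  have "((\<lambda>x. \<xi> ((cmap c \<circ> cinv ?d) x)) has_derivative
      (\<lambda>v. \<xi> (fderiv (cmap c \<circ> cinv ?d) (cmap ?d q) v))) (at (cmap ?d q))"
    by (rule bounded_linear.has_derivative[OF blinfun.bounded_linear_right
      transition_has_derivative]) (use assms chart_at_mem in auto)
  then have "fderiv (\<lambda>x. \<xi> ((cmap c \<circ> cinv ?d) x)) (cmap ?d q) =
      \<xi> o\<^sub>L fderiv (cmap c \<circ> cinv ?d) (cmap ?d q)"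
    by (intro fderiv_eqI) (simp only: blinfun_apply_compose comp_def)
  then show ?thesis by (simp add: differential_def fun_rep_def comp_def to_chart_def Let_def)
qed

lemma smooth_fun_coordinate:
  assumes "c \<in> A"
  shows "smooth_fun A (cdom c) (\<lambda>q. blinfun_apply \<xi> (cmap c q))"
  unfolding smooth_fun_def
proof
  fix d assume d: "d \<in> A"
  have "smooth_on (cmap d ` (cdom d \<inter> cdom c)) (\<lambda>x. \<xi> ((cmap c \<circ> cinv d) x))"
    by (rule smooth_on_bounded_linear[OF open_cmap_image[OF d open_cdom[OF assms]]
      blinfun.bounded_linear_right smooth_on_transition[OF assms d]])
  then show "smooth_on (cmap d ` (cdom d \<inter> cdom c)) (fun_rep d (\<lambda>q. blinfun_apply \<xi> (cmap c q)))"
    by (simp add: fun_rep_def comp_def)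
qed

text \<open>In another chart \<open>d\<close> the component is \<xi> composed with the Jacobian of
  the transition map, which is smooth by \<open>smooth_on_fderiv\<close>. These forms later make up
  a local coframe.\<close>

lemma smooth_form_coordinate:
  assumes "c \<in> A"
  shows "smooth_form A (cdom c) (\<lambda>q. \<xi> o\<^sub>L to_chart A c q)"
  unfolding smooth_form_def
proof
  fix d assume d: "d \<in> A"
  let ?S = "cmap d ` (cdom d \<inter> cdom c)"
  note op = open_cmap_image[OF d open_cdom[OF assms]]
  obtain B :: "'e set" where B: "orthonormal_basis B" by (rule orthonormal_basis_model)
  have "smooth_on ?S (fderiv (cmap c \<circ> cinv d))"
    by (rule smooth_on_fderiv[OF B op smooth_on_transition[OF assms d]])
  then have "smooth_on ?S (\<lambda>x. \<xi> o\<^sub>L fderiv (cmap c \<circ> cinv d) x)"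
    by (rule smooth_on_bounded_linear[OF op bounded_bilinear.bounded_linear_right[OF
      bounded_bilinear_blinfun_compose]])
  then show "smooth_on ?S (form_rep A d (\<lambda>q. \<xi> o\<^sub>L to_chart A c q))"
  proof (rule smooth_on_cong[OF op, rotated])
    fix x assume x: "x \<in> ?S"
    then obtain q where q: "q \<in> cdom d" "q \<in> cdom c" "x = cmap d q" by blast
    have "to_chart A c q o\<^sub>L from_chart A d q = fderiv (cmap c \<circ> cinv d) (cmap d q)"
      unfolding to_chart_def from_chart_def
      by (rule fderiv_transition_compose) (use q assms d chart_at_mem in auto)
    then show "\<xi> o\<^sub>L fderiv (cmap c \<circ> cinv d) x = form_rep A d (\<lambda>q. \<xi> o\<^sub>L to_chart A c q) x"
      using q d by (simp add: form_rep_def Let_def cinv_cmap blinfun_compose_assoc)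
  qed
qed

section \<open>Derivatives in the preferred chart\<close>

text \<open>The brackets at \<open>p\<close> contain only first derivatives there, so
  differentiability at the single point \<open>p\<close> is enough. It passes easily to
  \<open>dual_map (N q) (\<alpha> q)\<close>.\<close>

definition form_diff :: "'a \<Rightarrow> ('a \<Rightarrow> 'e dual) \<Rightarrow> bool" where
  "form_diff p \<alpha> \<longleftrightarrow> form_rep A (chart_at A p) \<alpha> differentiable (at (cmap (chart_at A p) p))"

definition vec_diff :: "'a \<Rightarrow> ('a \<Rightarrow> 'e) \<Rightarrow> bool" where
  "vec_diff p X \<longleftrightarrow> vec_rep A (chart_at A p) X differentiable (at (cmap (chart_at A p) p))"

definition sharp_diff :: "'a \<Rightarrow> ('a \<Rightarrow> 'e dual \<Rightarrow>\<^sub>L 'e) \<Rightarrow> bool" where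
  "sharp_diff p P \<longleftrightarrow> sharp_rep A (chart_at A p) P differentiable (at (cmap (chart_at A p) p))"

text \<open>This and the next two derivatives are the flat connection of the preferred chart at
  \<open>p\<close>; the Lie bracket, Lie derivative and exterior derivative at \<open>p\<close>
  become algebraic expressions in it.\<close>

definition form_D :: "'a \<Rightarrow> ('a \<Rightarrow> 'e dual) \<Rightarrow> 'e \<Rightarrow>\<^sub>L 'e dual" where
  "form_D p \<alpha> = fderiv (form_rep A (chart_at A p) \<alpha>) (cmap (chart_at A p) p)"

definition vec_D :: "'a \<Rightarrow> ('a \<Rightarrow> 'e) \<Rightarrow> 'e \<Rightarrow>\<^sub>L 'e" where
  "vec_D p X = fderiv (vec_rep A (chart_at A p) X) (cmap (chart_at A p) p)"

definition sharp_D :: "'a \<Rightarrow> ('a \<Rightarrow> 'e dual \<Rightarrow>\<^sub>L 'e) \<Rightarrow> 'e \<Rightarrow>\<^sub>L ('e dual \<Rightarrow>\<^sub>L 'e)" where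
  "sharp_D p P = fderiv (sharp_rep A (chart_at A p) P) (cmap (chart_at A p) p)"

lemma lie_bracket_eq: "lie_bracket A X Y p = vec_D p Y (X p) - vec_D p X (Y p)"
  by (simp add: lie_bracket_def vec_D_def Let_def)

lemma lie_deriv_eq: "lie_deriv A X \<eta> p = form_D p \<eta> (X p) + (\<eta> p o\<^sub>L vec_D p X)"
  by (simp add: lie_deriv_def vec_D_def form_D_def Let_def)

text \<open>\<open>Blinfun\<close> can be unfolded only after the contracted form is known to be
  bounded linear in \<open>w\<close>.\<close>

lemma interior_product_ext_deriv_apply:
  "blinfun_apply (interior_product Y (ext_deriv A \<xi>) p) w = form_D p \<xi> (Y p) w - form_D p \<xi> w (Y p)"
proof -
  have "bounded_linear (\<lambda>w. form_D p \<xi> (Y p) w - form_D p \<xi> w (Y p))"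
    by (intro bounded_linear_sub blinfun.bounded_linear_right
      bounded_linear_compose[OF blinfun.bounded_linear_left[of "Y p"] blinfun.bounded_linear_right])
  then show ?thesis
    by (simp add: interior_product_def ext_deriv_def form_D_def Let_def bounded_linear_Blinfun_apply)
qed

lemma cmap_mem: "cmap (chart_at A p) p \<in> cmap (chart_at A p) ` cdom (chart_at A p)"
  using chart_at_mem by blast

section \<open>Leibniz rules in components\<close>

lemma smooth_form_form_diff: "smooth_form A UNIV \<alpha> \<Longrightarrow> form_diff p \<alpha>"
  unfolding smooth_form_def form_diff_def
  by (intro smooth_on_imp_differentiable[OF _ cmap_mem]) (simp add: chart_at_mem)

lemma bivector_sharp_diff: "bivector A P \<Longrightarrow> sharp_diff p P"
  unfolding bivector_def sharp_diff_def
  by (intro smooth_on_imp_differentiable[OF _ cmap_mem]) (simp add: chart_at_mem)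

lemma vec_rep_sharp_has_derivative:
  assumes "sharp_diff p P" "form_diff p \<alpha>"
  shows "(vec_rep A (chart_at A p) (\<lambda>q. P q (\<alpha> q)) has_derivative
    (\<lambda>w. P p (form_D p \<alpha> w) + sharp_D p P w (\<alpha> p))) (at (cmap (chart_at A p) p))"
proof -
  let ?c = "chart_at A p" and ?x = "cmap (chart_at A p) p"
  have "((\<lambda>x. sharp_rep A ?c P x (form_rep A ?c \<alpha> x)) has_derivative
      (\<lambda>w. sharp_rep A ?c P ?x (form_D p \<alpha> w) + sharp_D p P w (form_rep A ?c \<alpha> ?x))) (at ?x)"
    using assms unfolding form_D_def sharp_D_def sharp_diff_def form_diff_def
    by (intro bounded_bilinear.FDERIV[OF bounded_bilinear_blinfun_apply] has_derivative_fderiv)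
  then have "((\<lambda>x. sharp_rep A ?c P x (form_rep A ?c \<alpha> x)) has_derivative
      (\<lambda>w. P p (form_D p \<alpha> w) + sharp_D p P w (\<alpha> p))) (at ?x)"
    by simp
  then show ?thesis
    by (rule has_derivative_transform_within_open[OF _ open_cmap_cdom cmap_mem])
      (use vec_rep_sharp chart_at_mem in auto)
qed

lemma vec_diff_sharp:
  "sharp_diff p P \<Longrightarrow> form_diff p \<alpha> \<Longrightarrow> vec_diff p (\<lambda>q. P q (\<alpha> q))"
  using vec_rep_sharp_has_derivative unfolding vec_diff_def differentiable_def by blast

lemma vec_D_sharp:
  assumes "sharp_diff p P" "form_diff p \<alpha>"
  shows "vec_D p (\<lambda>q. P q (\<alpha> q)) w = P p (form_D p \<alpha> w) + sharp_D p P w (\<alpha> p)"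
  unfolding vec_D_def by (rule fderiv_apply_eqI[OF vec_rep_sharp_has_derivative[OF assms]])

lemma form_diff_dual_map:
  assumes "smooth_endo A N" "form_diff p \<alpha>"
  shows "form_diff p (\<lambda>q. dual_map (N q) (\<alpha> q))"
proof -
  let ?c = "chart_at A p" and ?x = "cmap (chart_at A p) p"
  have "endo_rep A ?c N differentiable (at ?x)"
    using assms(1)
    by (intro smooth_on_imp_differentiable[OF _ cmap_mem]) (simp add: smooth_endo_def chart_at_mem)
  then have "(\<lambda>x. form_rep A ?c \<alpha> x o\<^sub>L endo_rep A ?c N x) differentiable (at ?x)"
    using assms(2) bounded_bilinear.FDERIV[OF bounded_bilinear_blinfun_compose]
    unfolding form_diff_def differentiable_def by blast
  then show ?thesis unfolding form_diff_def
    by (rule differentiable_cong_open[OF _ open_cmap_cdom cmap_mem])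
      (use form_rep_dual_map chart_at_mem in auto)
qed

lemma differential_pairing:
  assumes "form_diff p \<beta>" "vec_diff p X"
  shows "differential A (\<lambda>q. blinfun_apply (\<beta> q) (X q)) p w =
    \<beta> p (vec_D p X w) + form_D p \<beta> w (X p)"
proof -
  let ?c = "chart_at A p" and ?x = "cmap (chart_at A p) p"
  have "((\<lambda>x. form_rep A ?c \<beta> x (vec_rep A ?c X x)) has_derivative
      (\<lambda>w. form_rep A ?c \<beta> ?x (vec_D p X w) + form_D p \<beta> w (vec_rep A ?c X ?x))) (at ?x)"
    using assms unfolding form_D_def vec_D_def vec_diff_def form_diff_def
    by (intro bounded_bilinear.FDERIV[OF bounded_bilinear_blinfun_apply] has_derivative_fderiv)
  then have "((\<lambda>x. form_rep A ?c \<beta> x (vec_rep A ?c X x)) has_derivative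
      (\<lambda>w. \<beta> p (vec_D p X w) + form_D p \<beta> w (X p))) (at ?x)"
    by simp
  then have der: "(fun_rep ?c (\<lambda>q. blinfun_apply (\<beta> q) (X q)) has_derivative
      (\<lambda>w. \<beta> p (vec_D p X w) + form_D p \<beta> w (X p))) (at ?x)"
    by (rule has_derivative_transform_within_open[OF _ open_cmap_cdom cmap_mem])
      (use fun_rep_pairing chart_at_mem in auto)
  show ?thesis by (simp add: differential_def Let_def fderiv_apply_eqI[OF der])
qed

section \<open>Skewness and the Koszul bracket of one-forms\<close>

lemma bivector_skew: "bivector A P \<Longrightarrow> blinfun_apply \<beta> (P p \<alpha>) = - blinfun_apply \<alpha> (P p \<beta>)"
  unfolding bivector_def by blast

lemma sharp_rep_skew:
  assumes "bivector A P"
  shows "blinfun_apply \<beta> (sharp_rep A c P x \<alpha>) = - blinfun_apply \<alpha> (sharp_rep A c P x \<beta>)"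
  using bivector_skew[OF assms, of "\<beta> o\<^sub>L to_chart A c (cinv c x)" "cinv c x" "\<alpha> o\<^sub>L to_chart A c (cinv c x)"]
  by (simp add: sharp_rep_def Let_def)

lemma sharp_D_has_derivative:
  assumes "sharp_diff p P"
  shows "((\<lambda>x. blinfun_apply \<beta> (sharp_rep A (chart_at A p) P x \<alpha>)) has_derivative
    (\<lambda>w. \<beta> (sharp_D p P w \<alpha>))) (at (cmap (chart_at A p) p))"
proof -
  have "bounded_linear (\<lambda>S. blinfun_apply \<beta> (blinfun_apply S \<alpha>))"
    by (rule bounded_linear_compose[OF blinfun.bounded_linear_right blinfun.bounded_linear_left])
  then show ?thesis
    by (rule bounded_linear.has_derivative)
      (use assms in \<open>simp add: sharp_D_def sharp_diff_def has_derivative_fderiv\<close>)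
qed

text \<open>The components of \<open>P\<close> are skew at every \<open>x\<close> against fixed
  covectors; differentiate this identity and use uniqueness of the derivative.\<close>

lemma sharp_D_skew:
  assumes "bivector A P"
  shows "blinfun_apply \<beta> (sharp_D p P w \<alpha>) = - blinfun_apply \<alpha> (sharp_D p P w \<beta>)"
proof -
  note der = sharp_D_has_derivative[OF bivector_sharp_diff[OF assms]]
  have "((\<lambda>x. blinfun_apply \<beta> (sharp_rep A (chart_at A p) P x \<alpha>)) has_derivative
      (\<lambda>w. - \<alpha> (sharp_D p P w \<beta>))) (at (cmap (chart_at A p) p))"
    unfolding sharp_rep_skew[OF assms, of \<beta>] by (rule has_derivative_minus[OF der])
  from has_derivative_unique[OF this der] show ?thesis by metis
qed

text \<open>After expansion, the derivative of \<alpha> along \<open>w\<close> cancels between the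
  first Lie derivative and the differential, and the two terms with the derivative of \<beta> along
  \<open>w\<close> cancel by skewness. Only the derivative of \<open>P\<close> along
  \<open>w\<close> is left.\<close>

lemma form_bracket_apply:
  assumes "bivector A P" "form_diff p \<alpha>" "form_diff p \<beta>"
  shows "form_bracket A P \<alpha> \<beta> p w =
    form_D p \<beta> (P p (\<alpha> p)) w - form_D p \<alpha> (P p (\<beta> p)) w + \<beta> p (sharp_D p P w (\<alpha> p))"
proof -
  note diff = bivector_sharp_diff[OF assms(1), of p]
  show ?thesis
    unfolding form_bracket_def
    using vec_diff_sharp[OF diff assms(2)] assms(2,3) sharp_D_skew[OF assms(1), of "\<alpha> p" p w "\<beta> p"]
      bivector_skew[OF assms(1), of "\<alpha> p" p "form_D p \<beta> w"]
    by (simp add: lie_deriv_eq differential_pairing vec_D_sharp[OF diff] blinfun.add_left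
        blinfun.diff_left blinfun.add_right)
qed

text \<open>The left side is the cotangent part of the Dorfman bracket of two sections of the graph
  of \<open>P\<close>. Skewness cancels the derivative of \<alpha> along \<open>w\<close>, which
  leaves the formula of \<open>form_bracket_apply\<close>.\<close>

lemma lie_deriv_minus_interior_product:
  assumes "bivector A P" "form_diff p \<alpha>" "form_diff p \<beta>"
  shows "lie_deriv A (\<lambda>q. P q (\<alpha> q)) \<beta> p - interior_product (\<lambda>q. P q (\<beta> q)) (ext_deriv A \<alpha>) p =
    form_bracket A P \<alpha> \<beta> p"
proof (rule blinfun_eqI)
  fix w
  note diff = bivector_sharp_diff[OF assms(1), of p]
  show "(lie_deriv A (\<lambda>q. P q (\<alpha> q)) \<beta> p - interior_product (\<lambda>q. P q (\<beta> q)) (ext_deriv A \<alpha>) p) w =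
      form_bracket A P \<alpha> \<beta> p w"
    using bivector_skew[OF assms(1), of "\<beta> p" p "form_D p \<alpha> w"] assms(2,3)
    by (simp add: form_bracket_apply[OF assms] lie_deriv_eq interior_product_ext_deriv_apply
        vec_D_sharp[OF diff] blinfun.add_left blinfun.diff_left blinfun.add_right)
qed

section \<open>The Jacobi identity in coordinates\<close>

lemma poisson_bracket_coordinate:
  assumes "c \<in> A" "q \<in> cdom c"
  shows "poisson_bracket A P (\<lambda>q. blinfun_apply \<xi> (cmap c q)) (\<lambda>q. blinfun_apply \<zeta> (cmap c q)) q =
    blinfun_apply \<zeta> (sharp_rep A c P (cmap c q) \<xi>)"
  using assms
  by (simp add: poisson_bracket_def differential_coordinate sharp_rep_def Let_def cinv_cmap)

text \<open>The inner bracket of two coordinate functions is a component of \<open>P\<close>, so the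
  outer bracket differentiates this component in the direction \<open>P p \<xi>\<close>.\<close>

lemma poisson_bracket_coordinate2:
  fixes p :: 'a and P :: "'a \<Rightarrow> 'e dual \<Rightarrow>\<^sub>L 'e"
  assumes "bivector A P"
  defines "f \<equiv> \<lambda>\<xi> q. blinfun_apply \<xi> (cmap (chart_at A p) q)"
  shows "poisson_bracket A P (f \<xi>) (poisson_bracket A P (f \<zeta>) (f \<eta>)) p =
    blinfun_apply \<eta> (sharp_D p P (P p \<xi>) \<zeta>)"
proof -
  let ?c = "chart_at A p" and ?x = "cmap (chart_at A p) p"
  have der: "(fun_rep ?c (poisson_bracket A P (f \<zeta>) (f \<eta>)) has_derivative
      (\<lambda>w. \<eta> (sharp_D p P w \<zeta>))) (at ?x)"
    using sharp_D_has_derivative[OF bivector_sharp_diff[OF assms(1)]]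
    by (rule has_derivative_transform_within_open[OF _ open_cmap_cdom cmap_mem])
      (use chart_at_mem cinv_mem cmap_cinv in
        \<open>auto simp: fun_rep_def f_def poisson_bracket_coordinate cinv_cmap\<close>)
  have 1: "differential A (poisson_bracket A P (f \<zeta>) (f \<eta>)) p w = \<eta> (sharp_D p P w \<zeta>)" for w
    by (simp add: differential_def Let_def fderiv_apply_eqI[OF der])
  have "differential A (f \<xi>) p = \<xi> o\<^sub>L to_chart A ?c p"
    unfolding f_def by (rule differential_coordinate) (use chart_at_mem in auto)
  then have "differential A (f \<xi>) p = \<xi>" by (intro blinfun_eqI) simp
  with 1 show ?thesis by (simp add: poisson_bracket_def)
qed

text \<open>This is the vanishing of the Schouten bracket of \<open>P\<close> with itself, written
  in components. Coordinate functions are smooth on the chart domain, and the Jacobi identity is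
  available on every open set.\<close>

lemma poisson_jacobi:
  assumes "poisson A P"
  shows "blinfun_apply \<eta> (sharp_D p P (P p \<xi>) \<zeta>) + blinfun_apply \<xi> (sharp_D p P (P p \<zeta>) \<eta>) +
    blinfun_apply \<zeta> (sharp_D p P (P p \<eta>) \<xi>) = 0"
proof -
  have biv: "bivector A P" using assms by (simp add: poisson_def)
  have "open (cdom (chart_at A p))" "p \<in> cdom (chart_at A p)"
    using open_cdom chart_at_mem by auto
  then show ?thesis
    using assms smooth_fun_coordinate[OF chart_at_mem(1)[of p]]
    unfolding poisson_def poisson_bracket_coordinate2[OF biv, symmetric] by blast
qed

text \<open>Pair both sides with a covector \<gamma>. The terms containing derivatives of \<alpha>
  and \<beta> agree by skewness of \<open>P\<close>; what remains is the Jacobi identity for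
  \<open>\<alpha> p\<close>, \<open>\<beta> p\<close> and \<gamma>.\<close>

lemma poisson_sharp_form_bracket:
  assumes "poisson A P" "form_diff p \<alpha>" "form_diff p \<beta>"
  shows "P p (form_bracket A P \<alpha> \<beta> p) = lie_bracket A (\<lambda>q. P q (\<alpha> q)) (\<lambda>q. P q (\<beta> q)) p"
proof (rule blinfun_separation)
  fix \<gamma> :: "'e dual"
  have biv: "bivector A P" using assms by (simp add: poisson_def)
  note diff = bivector_sharp_diff[OF biv, of p]
  show "blinfun_apply \<gamma> (P p (form_bracket A P \<alpha> \<beta> p)) =
      blinfun_apply \<gamma> (lie_bracket A (\<lambda>q. P q (\<alpha> q)) (\<lambda>q. P q (\<beta> q)) p)"
    using poisson_jacobi[OF assms(1), of \<gamma> p "\<alpha> p" "\<beta> p"] assms(2,3)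
      bivector_skew[OF biv, of \<gamma> p "form_bracket A P \<alpha> \<beta> p"]
      bivector_skew[OF biv, of \<gamma> p "form_D p \<beta> (P p (\<alpha> p))"]
      bivector_skew[OF biv, of \<gamma> p "form_D p \<alpha> (P p (\<beta> p))"]
      sharp_D_skew[OF biv, of \<gamma> p "P p (\<beta> p)" "\<alpha> p"]
    by (simp add: lie_bracket_eq vec_D_sharp[OF diff] form_bracket_apply[OF biv]
        blinfun.add_right blinfun.diff_right)
qed

end

section \<open>Graphs of complex bivectors\<close>

lemma poisson_nijenhuisD:
  assumes "poisson_nijenhuis A \<sigma> N"
  shows "poisson A \<sigma>" "bivector A \<sigma>" "nijenhuis_tensor A N" "smooth_endo A N"
    and "\<sigma> p (dual_map (N p) \<xi>) = N p (\<sigma> p \<xi>)"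
proof -
  show poi: "poisson A \<sigma>" and nij: "nijenhuis_tensor A N"
    using assms unfolding poisson_nijenhuis_def by - (elim conjE, assumption)+
  show "bivector A \<sigma>" using poi unfolding poisson_def by (elim conjE)
  show "smooth_endo A N" using nij unfolding nijenhuis_tensor_def by (elim conjE)
  have "\<sigma> p o\<^sub>L dual_map (N p) = N p o\<^sub>L \<sigma> p"
    using assms unfolding poisson_nijenhuis_def by (elim conjE allE)
  from arg_cong[OF this, of "\<lambda>T. blinfun_apply T \<xi>"]
  show "\<sigma> p (dual_map (N p) \<xi>) = N p (\<sigma> p \<xi>)"
    by (simp only: blinfun_apply_blinfun_compose)
qed

lemma mem_bivector_graph:
  "w \<in> bivector_graph (\<lambda>p. (Q p, P p)) p \<longleftrightarrow>
    fst (fst w) = Q p (snd (fst w)) - P p (snd (snd w)) \<and>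
    fst (snd w) = Q p (snd (snd w)) + P p (snd (fst w))"
  by (cases w) (auto simp: bivector_graph_def csharp_def)

lemma graph_section_mem:
  fixes P Q :: "'a \<Rightarrow> 'e::real_normed_vector dual \<Rightarrow>\<^sub>L 'e"
  shows "((Q p \<alpha>, \<alpha>), (P p \<alpha>, 0)) \<in> bivector_graph (\<lambda>p. (Q p, P p)) p"
  by (simp add: mem_bivector_graph)

lemma sum_cscale:
  "(\<Sum>i\<in>I. cscale (z i) (e i)) =
    ((\<Sum>i\<in>I. Re (z i) *\<^sub>R fst (e i) - Im (z i) *\<^sub>R snd (e i)),
     (\<Sum>i\<in>I. Re (z i) *\<^sub>R snd (e i) + Im (z i) *\<^sub>R fst (e i)))"
  by (induction I rule: infinite_finite_induct) (auto simp: cscale_def zero_prod_def)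

context smooth_atlas
begin

section \<open>Involutivity of the graph\<close>

lemma vec_rep_add: "vec_rep A c (\<lambda>q. X q + Y q) x = vec_rep A c X x + vec_rep A c Y x"
  by (simp add: vec_rep_def Let_def blinfun.add_right)

lemma vec_rep_diff: "vec_rep A c (\<lambda>q. X q - Y q) x = vec_rep A c X x - vec_rep A c Y x"
  by (simp add: vec_rep_def Let_def blinfun.diff_right)

lemma vec_D_add:
  assumes "vec_diff p X" "vec_diff p Y"
  shows "vec_D p (\<lambda>q. X q + Y q) = vec_D p X + vec_D p Y"
proof (rule blinfun_eqI)
  fix w
  have "((\<lambda>x. vec_rep A (chart_at A p) X x + vec_rep A (chart_at A p) Y x) has_derivative
      (\<lambda>w. vec_D p X w + vec_D p Y w)) (at (cmap (chart_at A p) p))"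
    using assms unfolding vec_D_def vec_diff_def
    by (intro has_derivative_add has_derivative_fderiv)
  then have "(vec_rep A (chart_at A p) (\<lambda>q. X q + Y q) has_derivative
      (\<lambda>w. vec_D p X w + vec_D p Y w)) (at (cmap (chart_at A p) p))"
    unfolding vec_rep_add[abs_def] .
  from fderiv_apply_eqI[OF this] show "vec_D p (\<lambda>q. X q + Y q) w = (vec_D p X + vec_D p Y) w"
    by (simp add: vec_D_def blinfun.add_left)
qed

lemma vec_D_diff:
  assumes "vec_diff p X" "vec_diff p Y"
  shows "vec_D p (\<lambda>q. X q - Y q) = vec_D p X - vec_D p Y"
proof (rule blinfun_eqI)
  fix w
  have "((\<lambda>x. vec_rep A (chart_at A p) X x - vec_rep A (chart_at A p) Y x) has_derivative
      (\<lambda>w. vec_D p X w - vec_D p Y w)) (at (cmap (chart_at A p) p))"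
    using assms unfolding vec_D_def vec_diff_def
    by (intro has_derivative_diff has_derivative_fderiv)
  then have "(vec_rep A (chart_at A p) (\<lambda>q. X q - Y q) has_derivative
      (\<lambda>w. vec_D p X w - vec_D p Y w)) (at (cmap (chart_at A p) p))"
    unfolding vec_rep_diff[abs_def] .
  from fderiv_apply_eqI[OF this] show "vec_D p (\<lambda>q. X q - Y q) w = (vec_D p X - vec_D p Y) w"
    by (simp add: vec_D_def blinfun.diff_left)
qed

text \<open>On real forms, the real part of the involutivity condition is the third identity minus
  the first, and its imaginary part is the second. Separate identities allow complex forms to be
  treated afterwards by bilinearity.\<close>

lemma twist_sharp_form_brackets:
  assumes "poisson_nijenhuis A \<sigma> N" "smooth_form A UNIV \<alpha>" "smooth_form A UNIV \<beta>"
  defines "X \<equiv> \<lambda>q. \<sigma> q (\<alpha> q)" and "Y \<equiv> \<lambda>q. \<sigma> q (\<beta> q)"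
    and "X' \<equiv> \<lambda>q. twist N \<sigma> q (\<alpha> q)" and "Y' \<equiv> \<lambda>q. twist N \<sigma> q (\<beta> q)"
  shows "\<sigma> p (form_bracket A \<sigma> \<alpha> \<beta> p) = lie_bracket A X Y p"
    and "twist N \<sigma> p (form_bracket A \<sigma> \<alpha> \<beta> p) + \<sigma> p (form_bracket A (twist N \<sigma>) \<alpha> \<beta> p) =
      lie_bracket A X' Y p + lie_bracket A X Y' p"
    and "twist N \<sigma> p (form_bracket A (twist N \<sigma>) \<alpha> \<beta> p) = lie_bracket A X' Y' p"
proof -
  note poi = poisson_nijenhuisD(1)[OF assms(1)] and biv = poisson_nijenhuisD(2)[OF assms(1)]
    and nij = poisson_nijenhuisD(3)[OF assms(1)] and endo = poisson_nijenhuisD(4)[OF assms(1)]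
    and comm = poisson_nijenhuisD(5)[OF assms(1)]
  have compat: "\<forall>\<alpha> \<beta>. smooth_form A UNIV \<alpha> \<and> smooth_form A UNIV \<beta> \<longrightarrow>
        (\<forall>p. form_bracket A (twist N \<sigma>) \<alpha> \<beta> p =
               form_bracket A \<sigma> (\<lambda>q. dual_map (N q) (\<alpha> q)) \<beta> p
               + form_bracket A \<sigma> \<alpha> (\<lambda>q. dual_map (N q) (\<beta> q)) p
               - dual_map (N p) (form_bracket A \<sigma> \<alpha> \<beta> p))"
    using assms(1) unfolding poisson_nijenhuis_def by (elim conjE)
  note diff = smooth_form_form_diff[OF assms(2), of p] smooth_form_form_diff[OF assms(3), of p]
  note diff' = diff[THEN form_diff_dual_map[OF endo]]
  show 1: "\<sigma> p (form_bracket A \<sigma> \<alpha> \<beta> p) = lie_bracket A X Y p"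
    using poisson_sharp_form_bracket[OF poi diff] by (simp add: X_def Y_def)
  \<comment> \<open>\<sigma> maps the transposed form \<open>dual_map (N q) (\<alpha> q)\<close> to
    \<open>X' q\<close>, so the Poisson identity for this form produces the bracket of
    \<open>X'\<close>.\<close>
  have 2: "\<sigma> p (form_bracket A \<sigma> (\<lambda>q. dual_map (N q) (\<alpha> q)) \<beta> p) = lie_bracket A X' Y p"
    using poisson_sharp_form_bracket[OF poi diff'(1) diff(2)]
    unfolding comm by (simp add: X'_def Y_def twist_def)
  have 3: "\<sigma> p (form_bracket A \<sigma> \<alpha> (\<lambda>q. dual_map (N q) (\<beta> q)) p) = lie_bracket A X Y' p"
    using poisson_sharp_form_bracket[OF poi diff(1) diff'(2)]
    unfolding comm by (simp add: X_def Y'_def twist_def)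
  have "form_bracket A (twist N \<sigma>) \<alpha> \<beta> p =
      form_bracket A \<sigma> (\<lambda>q. dual_map (N q) (\<alpha> q)) \<beta> p
      + form_bracket A \<sigma> \<alpha> (\<lambda>q. dual_map (N q) (\<beta> q)) p
      - dual_map (N p) (form_bracket A \<sigma> \<alpha> \<beta> p)"
    by (rule compat[rule_format, OF conjI[OF assms(2,3)]])
  then have 4: "\<sigma> p (form_bracket A (twist N \<sigma>) \<alpha> \<beta> p) =
      lie_bracket A X' Y p + lie_bracket A X Y' p - N p (lie_bracket A X Y p)"
    by (simp only: blinfun.add_right blinfun.diff_right comm 1 2 3)
  then show "twist N \<sigma> p (form_bracket A \<sigma> \<alpha> \<beta> p) + \<sigma> p (form_bracket A (twist N \<sigma>) \<alpha> \<beta> p) =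
      lie_bracket A X' Y p + lie_bracket A X Y' p"
    by (simp add: twist_def 1)
  \<comment> \<open>\<open>X\<close> and \<open>Y\<close> are globally smooth as images of global
    forms, so the torsion condition applies to them. The expression to which the torsion applies
    \<open>N\<close> is the right side of \<open>4\<close>.\<close>
  have "nijenhuis_torsion A N X Y p = 0"
    using nij smooth_vec_sharp[OF biv assms(2) open_UNIV] smooth_vec_sharp[OF biv assms(3) open_UNIV]
    unfolding nijenhuis_tensor_def X_def Y_def by blast
  then have "lie_bracket A X' Y' p =
      N p (lie_bracket A X' Y p + lie_bracket A X Y' p - N p (lie_bracket A X Y p))"
    by (simp add: nijenhuis_torsion_def twist_def X_def Y_def X'_def Y'_def)
  also have "\<dots> = N p (\<sigma> p (form_bracket A (twist N \<sigma>) \<alpha> \<beta> p))"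
    by (simp only: 4)
  also have "\<dots> = twist N \<sigma> p (form_bracket A (twist N \<sigma>) \<alpha> \<beta> p)"
    by (simp add: twist_def)
  finally show "twist N \<sigma> p (form_bracket A (twist N \<sigma>) \<alpha> \<beta> p) = lie_bracket A X' Y' p"
    by (rule sym)
qed

text \<open>Complex bilinearity reduces the bracket to the pairs \<open>(a, c)\<close>,
  \<open>(a, d)\<close>, \<open>(b, c)\<close> and \<open>(b, d)\<close> of real forms, to each of
  which \<open>twist_sharp_form_brackets\<close> applies.\<close>

lemma involutive_bivector_graph:
  assumes "poisson_nijenhuis A \<sigma> N"
  shows "involutive A (bivector_graph (\<lambda>p. (twist N \<sigma> p, \<sigma> p)))"
  unfolding involutive_def
proof (intro allI impI; elim conjE)
  fix u v p
  assume uv: "smooth_section A UNIV u" "smooth_section A UNIV v"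
    and mem: "\<forall>p. u p \<in> bivector_graph (\<lambda>p. (twist N \<sigma> p, \<sigma> p)) p"
      "\<forall>p. v p \<in> bivector_graph (\<lambda>p. (twist N \<sigma> p, \<sigma> p)) p"
  note D = poisson_nijenhuisD[OF assms]
  have biv: "bivector A \<sigma>" "bivector A (twist N \<sigma>)"
    by (rule D(2), rule bivector_twist[OF D(2,4,5)])
  \<comment> \<open>The form parts \<open>a + i b\<close> of \<open>u\<close> and
    \<open>c + i d\<close> of \<open>v\<close> determine the sections, since these lie in the graph;
    \<open>vecs\<close> recovers the vector parts.\<close>
  define a b c d where abcd: "a = snd \<circ> (fst \<circ> u)" "b = snd \<circ> (snd \<circ> u)"
    "c = snd \<circ> (fst \<circ> v)" "d = snd \<circ> (snd \<circ> v)"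
  have smooth: "smooth_form A UNIV a" "smooth_form A UNIV b"
    "smooth_form A UNIV c" "smooth_form A UNIV d"
    using uv by (simp_all add: abcd smooth_section_def comp_assoc)
  note diff = smooth[THEN smooth_form_form_diff, of p]
  note vdiff = diff[THEN vec_diff_sharp[OF bivector_sharp_diff[OF biv(1)]]]
    diff[THEN vec_diff_sharp[OF bivector_sharp_diff[OF biv(2)]]]
  have vecs: "fst \<circ> (fst \<circ> u) = (\<lambda>q. twist N \<sigma> q (a q) - \<sigma> q (b q))"
    "fst \<circ> (snd \<circ> u) = (\<lambda>q. twist N \<sigma> q (b q) + \<sigma> q (a q))"
    "fst \<circ> (fst \<circ> v) = (\<lambda>q. twist N \<sigma> q (c q) - \<sigma> q (d q))"
    "fst \<circ> (snd \<circ> v) = (\<lambda>q. twist N \<sigma> q (d q) + \<sigma> q (c q))"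
    using mem by (auto simp: mem_bivector_graph abcd)
  let ?K = "\<lambda>P \<alpha> \<beta>. form_bracket A P \<alpha> \<beta> p"
  \<comment> \<open>\<open>?F + i ?G\<close> is the complex Koszul bracket of \<open>a + i b\<close>
    and \<open>c + i d\<close> for \<pi> = \<open>twist N \<sigma> + i \<sigma>\<close>.\<close>
  let ?F = "?K (twist N \<sigma>) a c - ?K \<sigma> b c - ?K \<sigma> a d - ?K (twist N \<sigma>) b d"
  let ?G = "?K (twist N \<sigma>) a d - ?K \<sigma> b d + ?K \<sigma> a c + ?K (twist N \<sigma>) b c"
  have lie_deriv_diff: "lie_deriv A (\<lambda>q. X q - Y q) \<eta> p = lie_deriv A X \<eta> p - lie_deriv A Y \<eta> p"
    if "vec_diff p X" "vec_diff p Y" for X Y \<eta>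
    using that by (intro blinfun_eqI)
      (simp add: lie_deriv_eq vec_D_diff blinfun.diff_left blinfun.diff_right blinfun.add_left)
  have lie_deriv_add: "lie_deriv A (\<lambda>q. X q + Y q) \<eta> p = lie_deriv A X \<eta> p + lie_deriv A Y \<eta> p"
    if "vec_diff p X" "vec_diff p Y" for X Y \<eta>
    using that by (intro blinfun_eqI)
      (simp add: lie_deriv_eq vec_D_add blinfun.add_left blinfun.add_right)
  have interior_diff: "interior_product (\<lambda>q. X q - Y q) (ext_deriv A \<xi>) p =
      interior_product X (ext_deriv A \<xi>) p - interior_product Y (ext_deriv A \<xi>) p" for X Y \<xi>
    by (intro blinfun_eqI)
      (simp add: interior_product_ext_deriv_apply blinfun.diff_left blinfun.diff_right)
  have interior_add: "interior_product (\<lambda>q. X q + Y q) (ext_deriv A \<xi>) p =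
      interior_product X (ext_deriv A \<xi>) p + interior_product Y (ext_deriv A \<xi>) p" for X Y \<xi>
    by (intro blinfun_eqI)
      (simp add: interior_product_ext_deriv_apply blinfun.add_left blinfun.add_right)
  note koszul = lie_deriv_minus_interior_product[OF biv(1), of p, symmetric]
    lie_deriv_minus_interior_product[OF biv(2), of p, symmetric]
  have F: "snd (fst (cdorfman A u v p)) = ?F"
    by (simp add: cdorfman_def dorfman_def Let_def vecs abcd(1-4)[symmetric] lie_deriv_diff
        lie_deriv_add interior_diff interior_add vdiff koszul diff)
  have G: "snd (snd (cdorfman A u v p)) = ?G"
    by (simp add: cdorfman_def dorfman_def Let_def vecs abcd(1-4)[symmetric] lie_deriv_diff
        lie_deriv_add interior_diff interior_add vdiff koszul diff)
  note brackets = twist_sharp_form_brackets[OF assms smooth(1) smooth(3), of p]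
    twist_sharp_form_brackets[OF assms smooth(1) smooth(4), of p]
    twist_sharp_form_brackets[OF assms smooth(2) smooth(3), of p]
    twist_sharp_form_brackets[OF assms smooth(2) smooth(4), of p]
  have lie_add1: "lie_bracket A (\<lambda>q. X q + Y q) Z p = lie_bracket A X Z p + lie_bracket A Y Z p"
    and lie_add2: "lie_bracket A Z (\<lambda>q. X q + Y q) p = lie_bracket A Z X p + lie_bracket A Z Y p"
    and lie_diff1: "lie_bracket A (\<lambda>q. X q - Y q) Z p = lie_bracket A X Z p - lie_bracket A Y Z p"
    and lie_diff2: "lie_bracket A Z (\<lambda>q. X q - Y q) p = lie_bracket A Z X p - lie_bracket A Z Y p"
    if "vec_diff p X" "vec_diff p Y" for X Y Z
    using that by (simp_all add: lie_bracket_eq vec_D_add vec_D_diff blinfun.add_left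
        blinfun.add_right blinfun.diff_left blinfun.diff_right)
  let ?Q = "twist N \<sigma>"
  \<comment> \<open>The real part of \<pi> applied to \<open>?F + i ?G\<close>, with the mixed terms
    paired as in the second identity of \<open>twist_sharp_form_brackets\<close>. The imaginary part
    below is grouped in the same way.\<close>
  have "?Q p ?F - \<sigma> p ?G = ?Q p (?K ?Q a c) - ?Q p (?K ?Q b d)
      - (?Q p (?K \<sigma> b c) + \<sigma> p (?K ?Q b c)) - (?Q p (?K \<sigma> a d) + \<sigma> p (?K ?Q a d))
      + \<sigma> p (?K \<sigma> b d) - \<sigma> p (?K \<sigma> a c)"
    by (simp add: blinfun.add_right blinfun.diff_right)
  also have "\<dots> = fst (fst (cdorfman A u v p))"
    unfolding brackets
    by (simp add: cdorfman_def dorfman_def Let_def vecs lie_add1 lie_add2 lie_diff1 lie_diff2 vdiff)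
  finally have V: "fst (fst (cdorfman A u v p)) = ?Q p ?F - \<sigma> p ?G" by (rule sym)
  have "?Q p ?G + \<sigma> p ?F = ?Q p (?K ?Q a d) + ?Q p (?K ?Q b c)
      + (?Q p (?K \<sigma> a c) + \<sigma> p (?K ?Q a c)) - (?Q p (?K \<sigma> b d) + \<sigma> p (?K ?Q b d))
      - \<sigma> p (?K \<sigma> b c) - \<sigma> p (?K \<sigma> a d)"
    by (simp add: blinfun.add_right blinfun.diff_right)
  also have "\<dots> = fst (snd (cdorfman A u v p))"
    unfolding brackets
    by (simp add: cdorfman_def dorfman_def Let_def vecs lie_add1 lie_add2 lie_diff1 lie_diff2 vdiff)
  finally have W: "fst (snd (cdorfman A u v p)) = ?Q p ?G + \<sigma> p ?F" by (rule sym)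
  show "cdorfman A u v p \<in> bivector_graph (\<lambda>p. (twist N \<sigma> p, \<sigma> p)) p"
    unfolding mem_bivector_graph F G V W by simp
qed

text \<open>Projection to the form part is an isomorphism from the graph onto the complexified
  cotangent space, so a real coframe lifts to a complex frame of the graph. The coordinate coframe
  of the preferred chart at \<open>p\<close> is lifted.\<close>

lemma csubbundle_bivector_graph:
  fixes P Q :: "'a \<Rightarrow> 'e dual \<Rightarrow>\<^sub>L 'e"
  assumes "bivector A Q" "bivector A P"
  shows "csubbundle A (bivector_graph (\<lambda>p. (Q p, P p)))"
  unfolding csubbundle_def
proof
  fix p
  obtain B :: "'e set" where B: "orthonormal_basis B" by (rule orthonormal_basis_model)
  then have "finite B" by (simp add: orthonormal_basis_def)
  then obtain h where h: "bij_betw h {..<card B} B"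
    using ex_bij_betw_nat_finite[of B] by (auto simp: atLeast0LessThan)
  let ?c = "chart_at A p" and ?k = "card B"
  define \<alpha> where "\<alpha> i q = blinfun_inner_right (h i) o\<^sub>L to_chart A ?c q" for i q
  define e where "e i q = ((Q q (\<alpha> i q), \<alpha> i q), (P q (\<alpha> i q), 0 :: 'e dual))" for i q
  have c: "?c \<in> A" "p \<in> cdom ?c" by (rule chart_at_mem)+
  have op: "open (cdom ?c)" using c open_cdom by blast
  have smooth_\<alpha>: "smooth_form A (cdom ?c) (\<alpha> i)" for i
    unfolding \<alpha>_def by (rule smooth_form_coordinate[OF c(1)])
  have "form_rep A d (\<lambda>q. 0) = (\<lambda>x. 0)" for d
    by (simp add: form_rep_def Let_def)
  then have "smooth_form A U (\<lambda>q. 0)" for U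
    by (simp add: smooth_form_def smooth_on_const)
  then have smooth: "smooth_section A (cdom ?c) (e i)" for i
    using smooth_\<alpha>[of i] smooth_vec_sharp[OF assms(1) smooth_\<alpha>[of i] op]
      smooth_vec_sharp[OF assms(2) smooth_\<alpha>[of i] op]
    by (simp add: smooth_section_def e_def comp_def)
  have sum_e: "(\<Sum>i<?k. cscale (z i) (e i q)) =
      ((Q q (\<Sum>i<?k. Re (z i) *\<^sub>R \<alpha> i q) - P q (\<Sum>i<?k. Im (z i) *\<^sub>R \<alpha> i q),
        \<Sum>i<?k. Re (z i) *\<^sub>R \<alpha> i q),
       (P q (\<Sum>i<?k. Re (z i) *\<^sub>R \<alpha> i q) + Q q (\<Sum>i<?k. Im (z i) *\<^sub>R \<alpha> i q),
        \<Sum>i<?k. Im (z i) *\<^sub>R \<alpha> i q))" for z q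
    by (simp add: sum_cscale e_def prod_eq_iff fst_sum snd_sum sum.distrib sum_subtractf
        blinfun.sum_right blinfun.scaleR_right)
  \<comment> \<open>The vectors \<open>from_chart A ?c q (h j)\<close> form the frame dual to the
    coframe, so evaluation on them reads off coefficients.\<close>
  have coord: "(\<Sum>i<?k. r i *\<^sub>R \<alpha> i q) (from_chart A ?c q (h j)) = r j"
    if "q \<in> cdom ?c" "j < ?k" for r q j
  proof -
    have "(\<Sum>i<?k. r i *\<^sub>R \<alpha> i q) (from_chart A ?c q (h j)) = (\<Sum>i<?k. r i * (h i \<bullet> h j))"
      using that c by (simp add: blinfun.sum_left blinfun.scaleR_left \<alpha>_def)
    also have "\<dots> = (\<Sum>i<?k. if i = j then r i else 0)"
    proof (rule sum.cong)
      fix i assume "i \<in> {..<?k}"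
      then have "h i \<in> B" "h j \<in> B" "h i = h j \<longleftrightarrow> i = j"
        using h that(2) by (auto simp: bij_betw_def inj_on_def)
      then show "r i * (h i \<bullet> h j) = (if i = j then r i else 0)"
        using B by (simp add: orthonormal_basis_def)
    qed simp
    also have "\<dots> = r j" using that by simp
    finally show ?thesis .
  qed
  have expand: "\<xi> = (\<Sum>i<?k. \<xi> (from_chart A ?c q (h i)) *\<^sub>R \<alpha> i q)"
    if "q \<in> cdom ?c" for \<xi> :: "'e dual" and q
  proof (rule blinfun_eqI)
    fix v
    let ?w = "to_chart A ?c q v"
    have "\<xi> v = (\<xi> o\<^sub>L from_chart A ?c q) ?w" using that c by simp
    also have "\<dots> = (\<Sum>b\<in>B. (?w \<bullet> b) *\<^sub>R (\<xi> o\<^sub>L from_chart A ?c q) b)"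
      by (rule orthonormal_basis_blinfun_expansion[OF B])
    also have "\<dots> = (\<Sum>i<?k. (?w \<bullet> h i) *\<^sub>R (\<xi> o\<^sub>L from_chart A ?c q) (h i))"
      by (rule sum.reindex_bij_betw[OF h, symmetric])
    also have "\<dots> = (\<Sum>i<?k. \<xi> (from_chart A ?c q (h i)) *\<^sub>R \<alpha> i q) v"
      by (simp add: blinfun.sum_left blinfun.scaleR_left \<alpha>_def mult.commute inner_commute)
    finally show "\<xi> v = (\<Sum>i<?k. \<xi> (from_chart A ?c q (h i)) *\<^sub>R \<alpha> i q) v" .
  qed
  have range: "bivector_graph (\<lambda>p. (Q p, P p)) q = range (\<lambda>z. \<Sum>i<?k. cscale (z i) (e i q))"
    if q: "q \<in> cdom ?c" for q
  proof (intro equalityI subsetI)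
    fix w assume "w \<in> bivector_graph (\<lambda>p. (Q p, P p)) q"
    then obtain \<xi> \<eta> where w: "w = ((Q q \<xi> - P q \<eta>, \<xi>), (Q q \<eta> + P q \<xi>, \<eta>))"
      by (auto simp: bivector_graph_def csharp_def)
    \<comment> \<open>Real and imaginary parts are the coefficients of \<xi> and \<eta> in the
      coframe; the vector parts then agree by linearity.\<close>
    define z where "z i = Complex (\<xi> (from_chart A ?c q (h i))) (\<eta> (from_chart A ?c q (h i)))" for i
    have "w = (\<Sum>i<?k. cscale (z i) (e i q))"
      unfolding sum_e z_def complex.sel expand[OF q, of \<xi>, symmetric]
        expand[OF q, of \<eta>, symmetric] w by simp
    then show "w \<in> range (\<lambda>z. \<Sum>i<?k. cscale (z i) (e i q))" by (rule range_eqI[of _ _ z])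
  next
    fix w assume "w \<in> range (\<lambda>z. \<Sum>i<?k. cscale (z i) (e i q))"
    then show "w \<in> bivector_graph (\<lambda>p. (Q p, P p)) q"
      by (rule rangeE) (simp add: sum_e mem_bivector_graph)
  qed
  have indep: "z j = 0"
    if q: "q \<in> cdom ?c" and 0: "(\<Sum>i<?k. cscale (z i) (e i q)) = 0" and j: "j < ?k" for z q j
  proof -
    have "(\<Sum>i<?k. Re (z i) *\<^sub>R \<alpha> i q) = 0" "(\<Sum>i<?k. Im (z i) *\<^sub>R \<alpha> i q) = 0"
      using 0 unfolding sum_e by (simp_all add: zero_prod_def)
    then show "z j = 0"
      using coord[OF q j, of "\<lambda>i. Re (z i)"] coord[OF q j, of "\<lambda>i. Im (z i)"]
      by (simp add: complex_eq_iff)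
  qed
  show "\<exists>U (k::nat) e. open U \<and> p \<in> U \<and> (\<forall>i<k. smooth_section A U (e i)) \<and>
      (\<forall>q\<in>U. bivector_graph (\<lambda>p. (Q p, P p)) q = range (\<lambda>z::nat \<Rightarrow> complex. \<Sum>i<k. cscale (z i) (e i q)) \<and>
         (\<forall>z::nat \<Rightarrow> complex. (\<Sum>i<k. cscale (z i) (e i q)) = 0 \<longrightarrow> (\<forall>i<k. z i = 0)))"
    by (rule exI[of _ "cdom ?c"], rule exI[of _ ?k], rule exI[of _ e],
        intro conjI allI ballI impI op c(2) smooth range; (rule indep)?; assumption)
qed

end

text \<open>Write \<pi> = \<open>S + i T\<close>. Twice the pairing of \<open>u\<close> with the
  graph element over \<open>\<xi> + i \<eta>\<close> is this covector evaluated on the defect of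
  \<open>u\<close>, its vector part minus \<pi> of its form part. The defect vanishes exactly on the
  graph.\<close>

lemma cpairing_bivector_graph:
  fixes S T :: "'e::real_normed_vector dual \<Rightarrow>\<^sub>L 'e"
  assumes skew: "\<And>\<alpha> \<beta>. blinfun_apply \<beta> (S \<alpha>) = - blinfun_apply \<alpha> (S \<beta>)"
    "\<And>\<alpha> \<beta>. blinfun_apply \<beta> (T \<alpha>) = - blinfun_apply \<alpha> (T \<beta>)"
    and w: "w = ((S \<xi> - T \<eta>, \<xi>), (S \<eta> + T \<xi>, \<eta>))"
  shows "2 * Re (cpairing u w) = \<xi> (fst (fst u) - S (snd (fst u)) + T (snd (snd u)))
      - \<eta> (fst (snd u) - S (snd (snd u)) - T (snd (fst u)))"
    and "2 * Im (cpairing u w) = \<eta> (fst (fst u) - S (snd (fst u)) + T (snd (snd u)))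
      + \<xi> (fst (snd u) - S (snd (snd u)) - T (snd (fst u)))"
  using skew(1)[of "snd (fst u)" \<xi>] skew(1)[of "snd (fst u)" \<eta>]
    skew(1)[of "snd (snd u)" \<xi>] skew(1)[of "snd (snd u)" \<eta>]
    skew(2)[of "snd (fst u)" \<xi>] skew(2)[of "snd (fst u)" \<eta>]
    skew(2)[of "snd (snd u)" \<xi>] skew(2)[of "snd (snd u)" \<eta>]
  by (simp_all add: w cpairing_def pairing_def blinfun.add_right blinfun.diff_right field_simps)

lemma lagrangian_bivector_graph:
  fixes Q P :: "'a \<Rightarrow> 'e::real_inner dual \<Rightarrow>\<^sub>L 'e"
  assumes "bivector A Q" "bivector A P"
  shows "lagrangian (bivector_graph (\<lambda>p. (Q p, P p)))"
  unfolding lagrangian_def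
proof (intro allI equalityI subsetI CollectI ballI)
  fix p :: 'a
  have skew: "blinfun_apply \<beta> (Q p \<alpha>) = - blinfun_apply \<alpha> (Q p \<beta>)"
    "blinfun_apply \<beta> (P p \<alpha>) = - blinfun_apply \<alpha> (P p \<beta>)" for \<alpha> \<beta>
    using assms unfolding bivector_def by blast+
  let ?L = "bivector_graph (\<lambda>p. (Q p, P p)) p"
  {
    fix u w assume "u \<in> ?L" "w \<in> ?L"
    from \<open>w \<in> ?L\<close> obtain \<xi> \<eta> where w: "w = ((Q p \<xi> - P p \<eta>, \<xi>), (Q p \<eta> + P p \<xi>, \<eta>))"
      by (auto simp: bivector_graph_def csharp_def)
    show "cpairing u w = 0"
      using cpairing_bivector_graph[where S = "Q p" and T = "P p" and u = u, OF skew w] \<open>u \<in> ?L\<close>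
      by (simp add: mem_bivector_graph complex_eq_iff)
  next
    fix u assume u: "u \<in> {u. \<forall>v\<in>?L. cpairing u v = 0}"
    \<comment> \<open>Elements over real covectors suffice for testing: the real and imaginary parts
      of the pairing give the two parts of the defect, and covectors separate vectors.\<close>
    have *: "cpairing u ((Q p \<xi>, \<xi>), (P p \<xi>, 0)) = 0" for \<xi>
      using u graph_section_mem[of Q p \<xi> P] by blast
    have "\<xi> (fst (fst u) - Q p (snd (fst u)) + P p (snd (snd u))) = \<xi> 0"
      "\<xi> (fst (snd u) - Q p (snd (snd u)) - P p (snd (fst u))) = \<xi> 0" for \<xi> :: "'e dual"
      using cpairing_bivector_graph[where S = "Q p" and T = "P p" and u = u and \<xi> = \<xi> and \<eta> = 0, OF skew refl]
        *[of \<xi>] by simp_all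
    from this[THEN blinfun_separation] show "u \<in> ?L"
      by (simp add: mem_bivector_graph algebra_simps)
  }
qed

text \<open>An element of the intersection lies in the graphs of both \<open>Q + i P\<close> and
  \<open>Q - i P\<close>. Subtracting the two conditions gives \<open>2 P = 0\<close> on both parts
  of its form component, and injectivity of \<open>P p\<close> makes them vanish.\<close>

lemma bivector_graph_Int_cconj:
  fixes P Q :: "'a \<Rightarrow> 'e::real_normed_vector dual \<Rightarrow>\<^sub>L 'e"
  assumes "inj (blinfun_apply (P p))"
  shows "bivector_graph (\<lambda>p. (Q p, P p)) p \<inter> cconj ` bivector_graph (\<lambda>p. (Q p, P p)) p = {0}"
proof (intro equalityI subsetI)
  fix u assume u: "u \<in> bivector_graph (\<lambda>p. (Q p, P p)) p \<inter> cconj ` bivector_graph (\<lambda>p. (Q p, P p)) p"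
  then have "cconj u \<in> bivector_graph (\<lambda>p. (Q p, P p)) p" by (auto simp: cconj_def)
  with u have eq: "fst (fst u) = Q p (snd (fst u)) - P p (snd (snd u))"
      "fst (snd u) = Q p (snd (snd u)) + P p (snd (fst u))"
      "fst (fst u) = Q p (snd (fst u)) + P p (snd (snd u))"
      "- fst (snd u) = - Q p (snd (snd u)) + P p (snd (fst u))"
    by (simp_all add: mem_bivector_graph cconj_def blinfun.minus_right)
  have "P p (snd (snd u)) + P p (snd (snd u)) = fst (fst u) - fst (fst u)"
    by (subst (2) eq(1), subst eq(3)) simp
  moreover have "P p (snd (fst u)) + P p (snd (fst u)) = fst (snd u) + - fst (snd u)"
    unfolding eq(4) by (subst eq(2)) simp
  ultimately have "2 *\<^sub>R P p (snd (snd u)) = 0" "2 *\<^sub>R P p (snd (fst u)) = 0"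
    by (simp_all add: scaleR_2)
  then have "P p (snd (snd u)) = P p 0" "P p (snd (fst u)) = P p 0" by simp_all
  then have "snd (snd u) = 0" "snd (fst u) = 0" by - (rule injD[OF assms], assumption)+
  with eq show "u \<in> {0}" by (simp add: prod_eq_iff)
next
  have "0 = (cconj 0 :: 'e gtan cplx)" "0 \<in> bivector_graph (\<lambda>p. (Q p, P p)) p"
    by (simp_all add: cconj_def mem_bivector_graph prod_eq_iff)
  then have "0 \<in> bivector_graph (\<lambda>p. (Q p, P p)) p \<inter> cconj ` bivector_graph (\<lambda>p. (Q p, P p)) p"
    by (intro IntI image_eqI[of 0 cconj 0])
  then show "u \<in> bivector_graph (\<lambda>p. (Q p, P p)) p \<inter> cconj ` bivector_graph (\<lambda>p. (Q p, P p)) p"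
    if "u \<in> {0}" for u
    using that by (simp only: singleton_iff)
qed

section \<open>The associated endomorphism\<close>

lemma associated_map_iff: "associated_map L J \<longleftrightarrow> (\<forall>p w. w \<in> L p \<longleftrightarrow> snd w = J p (fst w))"
  by (force simp: associated_map_def set_eq_iff)

text \<open>For \<open>w = ((X, \<xi>), (Y, \<eta>))\<close>, the real part of the graph equation is
  solved for \<eta> by inverting \<sigma>, which gives the lower row of the block matrix.
  Substituting this \<eta> into the imaginary part gives \<open>Y\<close> and with it the upper
  row.\<close>

lemma associated_map_bivector_graph:
  fixes \<sigma> :: "'a \<Rightarrow> 'e::real_normed_vector dual \<Rightarrow>\<^sub>L 'e" and N :: "'a \<Rightarrow> 'e \<Rightarrow>\<^sub>L 'e"
  assumes comm: "\<And>p \<xi>. \<sigma> p (dual_map (N p) \<xi>) = N p (\<sigma> p \<xi>)"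
    and bij: "\<And>p. bij (blinfun_apply (\<sigma> p))"
  shows "associated_map (bivector_graph (\<lambda>p. (twist N \<sigma> p, \<sigma> p)))
      (\<lambda>p. block_map (\<lambda>X. - N p X) (\<lambda>\<xi>. twist N (twist N \<sigma>) p \<xi> + \<sigma> p \<xi>)
                     (\<lambda>X. - inv (blinfun_apply (\<sigma> p)) X) (\<lambda>\<xi>. dual_map (N p) \<xi>))"
proof -
  have "w \<in> bivector_graph (\<lambda>p. (twist N \<sigma> p, \<sigma> p)) p \<longleftrightarrow>
      snd w = block_map (\<lambda>X. - N p X) (\<lambda>\<xi>. twist N (twist N \<sigma>) p \<xi> + \<sigma> p \<xi>)
                     (\<lambda>X. - inv (blinfun_apply (\<sigma> p)) X) (\<lambda>\<xi>. dual_map (N p) \<xi>) (fst w)" for p w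
  proof -
    obtain X \<xi> Y \<eta> where w: "w = ((X, \<xi>), (Y, \<eta>))" by (metis prod.exhaust)
    define \<zeta> where "\<zeta> = inv (blinfun_apply (\<sigma> p)) X"
    have X: "X = \<sigma> p \<zeta>" unfolding \<zeta>_def using bij by (simp add: bij_is_surj surj_f_inv_f)
    have "X = N p (\<sigma> p \<xi>) - \<sigma> p \<eta> \<longleftrightarrow> \<sigma> p \<eta> = \<sigma> p (dual_map (N p) \<xi> - \<zeta>)"
      unfolding X blinfun.diff_right comm by (auto simp: algebra_simps)
    also have "\<dots> \<longleftrightarrow> \<eta> = dual_map (N p) \<xi> - \<zeta>"
      using bij by (simp add: bij_is_inj inj_eq)
    finally have 1: "X = N p (\<sigma> p \<xi>) - \<sigma> p \<eta> \<longleftrightarrow> \<eta> = dual_map (N p) \<xi> - \<zeta>" .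
    have 2: "N p (\<sigma> p \<eta>) = N p (N p (\<sigma> p \<xi>)) - N p X" if "\<eta> = dual_map (N p) \<xi> - \<zeta>"
      unfolding that X blinfun.diff_right comm ..
    show ?thesis
      using 1 2 by (auto simp: w mem_bivector_graph block_map_def twist_def \<zeta>_def)
  qed
  then show ?thesis unfolding associated_map_iff by (intro allI)
qed

theorem corollary8p11:
  fixes A :: "('a::{t2_space, second_countable_topology}, 'e::real_inner) atlas"
    and \<sigma> :: "'a \<Rightarrow> 'e dual \<Rightarrow>\<^sub>L 'e"
    and N :: "'a \<Rightarrow> 'e \<Rightarrow>\<^sub>L 'e"
  assumes "smooth_manifold A"
    and "poisson_nijenhuis A \<sigma> N"
    and "\<forall>p. bij (blinfun_apply (\<sigma> p))"
  shows "generalized_complex A (bivector_graph (\<lambda>p. (twist N \<sigma> p, \<sigma> p))) \<and>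
    associated_map (bivector_graph (\<lambda>p. (twist N \<sigma> p, \<sigma> p)))
      (\<lambda>p. block_map (\<lambda>X. - N p X) (\<lambda>\<xi>. twist N (twist N \<sigma>) p \<xi> + \<sigma> p \<xi>)
                     (\<lambda>X. - inv (blinfun_apply (\<sigma> p)) X) (\<lambda>\<xi>. dual_map (N p) \<xi>))"
proof -
  interpret smooth_atlas A by unfold_locales (rule assms(1))
  note D = poisson_nijenhuisD[OF assms(2)]
  note biv = D(2) and biv' = bivector_twist[OF D(2,4,5)]
  have bij: "bij (blinfun_apply (\<sigma> p))" for p using assms(3) by (rule spec)
  have "bivector_graph (\<lambda>p. (twist N \<sigma> p, \<sigma> p)) p \<inter>
      cconj ` bivector_graph (\<lambda>p. (twist N \<sigma> p, \<sigma> p)) p = {0}" for p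
    by (rule bivector_graph_Int_cconj[where P = \<sigma> and p = p, OF bij_is_inj[OF bij]])
  with csubbundle_bivector_graph[OF biv' biv] lagrangian_bivector_graph[OF biv' biv]
    involutive_bivector_graph[OF assms(2)]
  have "generalized_complex A (bivector_graph (\<lambda>p. (twist N \<sigma> p, \<sigma> p)))"
    unfolding generalized_complex_def by (intro conjI allI)
  then show ?thesis
    by (rule conjI[OF _ associated_map_bivector_graph[of \<sigma> N, OF D(5) bij]])
qed

end
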